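(* Let $N$ be a Seifert manifold with Seifert invariants $\{e;(\epsilon,g);(a_1,b_1),\ldots,(a_n,b_n)\}$ and let $\pi_1(N)$ be given by the associated presentation with generators $s_1,\ldots,s_n,v_1,\ldots,v_{g'},h$. Let $0<m\le n$. If two morphisms from $\pi_1(N)$ to $\mathbb{Z}_2=\mathbb{Z}/2\mathbb{Z}$ both map $s_1,\ldots,s_m$ to $1$ and $h,s_{m+1},\ldots,s_n$ to $0$, then their kernels are isomorphic.
   Context: Seifert manifolds (orientable or not) are described by a list of Seifert invariants $\{e;(\epsilon,g);(a_1,b_1),\ldots,(a_n,b_n)\}$, not assumed normalized: $e$ is an integer, $g$ is the genus of the base surface, and for each $k$ the integers $a_k,b_k$ are coprime with $a_k\neq0$. The type $\epsilon$ is one of $o_1,o_2,n_1,n_2,n_3,n_4$ and determines signs $\varepsilon_1,\ldots,\varepsilon_{g'}\in\{1,-1\}$: - $o_1$: base orientable, total space orientable; all $\varepsilon_j=1$; - $o_2$: base orientable, total space non-orientable, $g\ge1$; all $\varepsilon_j=-1$; - $n_1$: base and total space non-orientable, $g\ge1$; all $\varepsilon_j=1$; - $n_2$: base non-orientable, total space orientable, $g\ge1$; all $\varepsilon_j=-1$; - $n_3$: base and total space non-orientable, $g\ge2$; $\varepsilon_1=1$ and all other $\varepsilon_j=-1$; - $n_4$: base and total space non-orientable, $g\ge3$; $\varepsilon_1=\varepsilon_2=1$ and all other $\varepsilon_j=-1$. If the base is orientable ($\epsilon=o_1,o_2$), $g'=2g$ and $V=[v_1,v_2]\cdots[v_{2g-1},v_{2g}]$,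 where $[x,y]=xyx^{-1}y^{-1}$. If the base is non-orientable ($\epsilon=n_1,\ldots,n_4$), $g'=g$ and $V=v_1^2\cdots v_g^2$. The fundamental group of the Seifert manifold with these invariants is the group with generators $s_1,\ldots,s_n,v_1,\ldots,v_{g'},h$ and relators $$[s_k,h],\quad s_k^{a_k}h^{b_k}\ (1\le k\le n);\qquad v_jhv_j^{-1}h^{-\varepsilon_j}\ (1\le j\le g');\qquad h^{-e}s_1\cdots s_nV.$$ *)

theory Defs
  imports "HOL-Algebra.Elementary_Groups"
begin

section \<open>Groups given by generators and relators\<close>

text \<open>A letter \<open>(x, True)\<close> stands for the generator \<open>x\<close>, and \<open>(x, False)\<close> for its inverse.\<close>

type_synonym 'x word = "('x \<times> bool) list"

definition words :: "'x set \<Rightarrow> 'x word set" where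
  "words X = lists (X \<times> UNIV)"

definition word_gen :: "'x \<Rightarrow> 'x word" where
  "word_gen x = [(x, True)]"

definition word_inv :: "'x word \<Rightarrow> 'x word" where
  "word_inv w = rev (map (\<lambda>(x, b). (x, \<not> b)) w)"

definition word_pow :: "'x word \<Rightarrow> int \<Rightarrow> 'x word" where
  "word_pow w k =
     (if 0 \<le> k then concat (replicate (nat k) w)
      else concat (replicate (nat (- k)) (word_inv w)))"

definition word_comm :: "'x word \<Rightarrow> 'x word \<Rightarrow> 'x word" where
  "word_comm u v = u @ v @ word_inv u @ word_inv v"

text \<open>
  Two words are identified when one is obtained from the other by finitely many insertions and
  deletions of subwords \<open>x x\<^sup>-\<^sup>1\<close>, \<open>x\<^sup>-\<^sup>1 x\<close> and of relators. The quotient is the free group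
  on \<open>X\<close> modulo the normal closure of \<open>R\<close>; see \<open>presented_group_universal\<close> and
  \<open>presented_group_hom_unique\<close> below.
\<close>

inductive_set word_rel :: "'x set \<Rightarrow> 'x word set \<Rightarrow> ('x word \<times> 'x word) set"
  for X :: "'x set" and R :: "'x word set"
where
  refl: "w \<in> words X \<Longrightarrow> (w, w) \<in> word_rel X R"
| sym: "(u, v) \<in> word_rel X R \<Longrightarrow> (v, u) \<in> word_rel X R"
| trans: "(u, v) \<in> word_rel X R \<Longrightarrow> (v, w) \<in> word_rel X R \<Longrightarrow> (u, w) \<in> word_rel X R"
| cancel: "u \<in> words X \<Longrightarrow> v \<in> words X \<Longrightarrow> x \<in> X \<Longrightarrow>
    (u @ [(x, b), (x, \<not> b)] @ v, u @ v) \<in> word_rel X R"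
| relator: "u \<in> words X \<Longrightarrow> v \<in> words X \<Longrightarrow> r \<in> R \<Longrightarrow> r \<in> words X \<Longrightarrow>
    (u @ r @ v, u @ v) \<in> word_rel X R"

definition presented_group :: "'x set \<Rightarrow> 'x word set \<Rightarrow> 'x word set monoid" where
  "presented_group X R =
     \<lparr>carrier = words X // word_rel X R,
      monoid.mult = (\<lambda>A B. \<Union>u\<in>A. \<Union>v\<in>B. word_rel X R `` {u @ v}),
      one = word_rel X R `` {[]}\<rparr>"

definition presented_gen :: "'x set \<Rightarrow> 'x word set \<Rightarrow> 'x \<Rightarrow> 'x word set" where
  "presented_gen X R x = word_rel X R `` {word_gen x}"

primrec word_eval :: "('a, 'm) monoid_scheme \<Rightarrow> ('x \<Rightarrow> 'a) \<Rightarrow> 'x word \<Rightarrow> 'a" where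
  "word_eval K \<phi> [] = \<one>\<^bsub>K\<^esub>"
| "word_eval K \<phi> (l # w) =
     (if snd l then \<phi> (fst l) else inv\<^bsub>K\<^esub> (\<phi> (fst l))) \<otimes>\<^bsub>K\<^esub> word_eval K \<phi> w"

lemma words_simps [simp]:
  "[] \<in> words X"
  "l # w \<in> words X \<longleftrightarrow> fst l \<in> X \<and> w \<in> words X"
  "u @ v \<in> words X \<longleftrightarrow> u \<in> words X \<and> v \<in> words X"
  by (auto simp: words_def mem_Times_iff)

lemma word_inv_in_words [simp]: "word_inv w \<in> words X \<longleftrightarrow> w \<in> words X"
  by (induction w) (auto simp: word_inv_def split_beta)

lemma word_gen_in_words [simp]: "word_gen x \<in> words X \<longleftrightarrow> x \<in> X"
  by (simp add: word_gen_def)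

lemma word_comm_in_words [simp]: "word_comm u v \<in> words X \<longleftrightarrow> u \<in> words X \<and> v \<in> words X"
  by (auto simp: word_comm_def)

lemma concat_in_words: "(\<And>w. w \<in> set ws \<Longrightarrow> w \<in> words X) \<Longrightarrow> concat ws \<in> words X"
  by (induction ws) auto

lemma word_pow_in_words: "w \<in> words X \<Longrightarrow> word_pow w k \<in> words X"
  by (auto simp: word_pow_def intro!: concat_in_words)

lemma word_rel_in_words: "(u, v) \<in> word_rel X R \<Longrightarrow> u \<in> words X \<and> v \<in> words X"
  by (induction rule: word_rel.induct) auto

lemma equiv_word_rel: "equiv (words X) (word_rel X R)"
  by (intro equivI refl_onI symI transI subsetI)
     (auto dest: word_rel_in_words intro: word_rel.refl word_rel.sym word_rel.trans)

lemma word_rel_context: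
  assumes "(u, v) \<in> word_rel X R" "p \<in> words X" "q \<in> words X"
  shows "(p @ u @ q, p @ v @ q) \<in> word_rel X R"
  using assms
proof (induction rule: word_rel.induct)
  case (refl w)
  then show ?case by (auto intro: word_rel.refl)
next
  case (sym u v)
  then show ?case by (auto intro: word_rel.sym)
next
  case (trans u v w)
  then show ?case by (auto intro: word_rel.trans)
next
  case (cancel u v x b)
  then show ?case using word_rel.cancel[of "p @ u" X "v @ q" x b R] by simp
next
  case (relator u v r)
  then show ?case using word_rel.relator[of "p @ u" X "v @ q" r R] by simp
qed

lemma word_rel_append:
  assumes "(u, u') \<in> word_rel X R" "(v, v') \<in> word_rel X R"
  shows "(u @ v, u' @ v') \<in> word_rel X R"
proof -
  have "(u @ v, u' @ v) \<in> word_rel X R"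
    using word_rel_context[OF assms(1), of "[]" v] assms word_rel_in_words by fastforce
  moreover have "(u' @ v, u' @ v') \<in> word_rel X R"
    using word_rel_context[OF assms(2), of u' "[]"] assms word_rel_in_words by fastforce
  ultimately show ?thesis by (rule word_rel.trans)
qed

lemma word_rel_inv:
  assumes "w \<in> words X"
  shows "(word_inv w @ w, []) \<in> word_rel X R"
  using assms
proof (induction w)
  case Nil
  then show ?case by (auto simp: word_inv_def intro: word_rel.refl)
next
  case (Cons l w)
  obtain x b where l: "l = (x, b)" by force
  have "(word_inv w @ [(x, \<not> b), (x, \<not> \<not> b)] @ w, word_inv w @ w) \<in> word_rel X R"
    using Cons.prems l by (intro word_rel.cancel) auto
  then show ?case
    using Cons l by (auto simp: word_inv_def intro: word_rel.trans)
qed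

lemma class_eq_iff:
  assumes "u \<in> words X" "v \<in> words X"
  shows "word_rel X R `` {u} = word_rel X R `` {v} \<longleftrightarrow> (u, v) \<in> word_rel X R"
  using eq_equiv_class_iff[OF equiv_word_rel assms] .

lemma presented_group_mult_class:
  assumes "u \<in> words X" "v \<in> words X"
  shows "word_rel X R `` {u} \<otimes>\<^bsub>presented_group X R\<^esub> word_rel X R `` {v} = word_rel X R `` {u @ v}"
proof -
  have "word_rel X R `` {u' @ v'} = word_rel X R `` {u @ v}"
    if "(u, u') \<in> word_rel X R" "(v, v') \<in> word_rel X R" for u' v'
    using word_rel_append[OF that] equiv_class_eq[OF equiv_word_rel] by metis
  then have *: "word_rel X R `` {u' @ v'} = word_rel X R `` {u @ v}"
    if "u' \<in> word_rel X R `` {u}" "v' \<in> word_rel X R `` {v}" for u' v'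
    using that by simp
  have "u \<in> word_rel X R `` {u}" "v \<in> word_rel X R `` {v}"
    using assms by (auto intro: word_rel.refl)
  then have "(\<Union>u'\<in>word_rel X R `` {u}. \<Union>v'\<in>word_rel X R `` {v}. word_rel X R `` {u' @ v'})
      = word_rel X R `` {u @ v}"
    using * by blast
  then show ?thesis
    by (simp add: presented_group_def)
qed

lemma presented_group_carrier: "carrier (presented_group X R) = words X // word_rel X R"
  by (simp add: presented_group_def)

lemma presented_group_one: "\<one>\<^bsub>presented_group X R\<^esub> = word_rel X R `` {[]}"
  by (simp add: presented_group_def)

lemma group_presented_group: "group (presented_group X R)"
proof (rule groupI)
  show "\<one>\<^bsub>presented_group X R\<^esub> \<in> carrier (presented_group X R)"
    by (auto simp: presented_group_carrier presented_group_one intro: quotientI)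
  fix A B C
  assume "A \<in> carrier (presented_group X R)"
  then obtain u where u: "u \<in> words X" "A = word_rel X R `` {u}"
    by (auto simp: presented_group_carrier elim: quotientE)
  show "\<one>\<^bsub>presented_group X R\<^esub> \<otimes>\<^bsub>presented_group X R\<^esub> A = A"
    using u by (simp add: presented_group_one presented_group_mult_class)
  have "word_rel X R `` {word_inv u} \<otimes>\<^bsub>presented_group X R\<^esub> A = \<one>\<^bsub>presented_group X R\<^esub>"
    using u by (simp add: presented_group_one presented_group_mult_class class_eq_iff word_rel_inv)
  then show "\<exists>B\<in>carrier (presented_group X R). B \<otimes>\<^bsub>presented_group X R\<^esub> A = \<one>\<^bsub>presented_group X R\<^esub>"
    using u by (auto simp: presented_group_carrier intro!: quotientI bexI[of _ "word_rel X R `` {word_inv u}"])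
  assume "B \<in> carrier (presented_group X R)"
  then obtain v where v: "v \<in> words X" "B = word_rel X R `` {v}"
    by (auto simp: presented_group_carrier elim: quotientE)
  show "A \<otimes>\<^bsub>presented_group X R\<^esub> B \<in> carrier (presented_group X R)"
    using u v by (auto simp: presented_group_carrier presented_group_mult_class intro: quotientI)
  assume "C \<in> carrier (presented_group X R)"
  then obtain w where w: "w \<in> words X" "C = word_rel X R `` {w}"
    by (auto simp: presented_group_carrier elim: quotientE)
  show "A \<otimes>\<^bsub>presented_group X R\<^esub> B \<otimes>\<^bsub>presented_group X R\<^esub> C =
        A \<otimes>\<^bsub>presented_group X R\<^esub> (B \<otimes>\<^bsub>presented_group X R\<^esub> C)"
    using u v w by (simp add: presented_group_mult_class)
qed

lemma presented_gen_closed: "x \<in> X \<Longrightarrow> presented_gen X R x \<in> carrier (presented_group X R)"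
  by (auto simp: presented_gen_def presented_group_carrier intro: quotientI)

lemma word_eval_closed:
  assumes "group K" "\<phi> \<in> X \<rightarrow> carrier K" "w \<in> words X"
  shows "word_eval K \<phi> w \<in> carrier K"
proof -
  interpret group K by fact
  show ?thesis using assms(2,3) by (induction w) auto
qed

lemma word_eval_append:
  assumes "group K" "\<phi> \<in> X \<rightarrow> carrier K" "u \<in> words X" "v \<in> words X"
  shows "word_eval K \<phi> (u @ v) = word_eval K \<phi> u \<otimes>\<^bsub>K\<^esub> word_eval K \<phi> v"
proof -
  interpret group K by fact
  have [simp]: "word_eval K \<phi> w \<in> carrier K" if "w \<in> words X" for w
    using word_eval_closed[OF assms(1,2) that] .
  show ?thesis using assms(2,3,4)
    by (induction u) (auto simp: m_assoc Pi_iff)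
qed

lemma word_eval_word_rel:
  assumes "group K" "\<phi> \<in> X \<rightarrow> carrier K" "\<And>r. r \<in> R \<Longrightarrow> word_eval K \<phi> r = \<one>\<^bsub>K\<^esub>"
    and "(u, v) \<in> word_rel X R"
  shows "word_eval K \<phi> u = word_eval K \<phi> v"
proof -
  interpret group K by fact
  have [simp]: "word_eval K \<phi> w \<in> carrier K" if "w \<in> words X" for w
    using word_eval_closed[OF assms(1,2) that] .
  note app = word_eval_append[OF assms(1,2)]
  show ?thesis using assms(4)
  proof (induction rule: word_rel.induct)
    case (cancel u v x b)
    have "\<phi> x \<in> carrier K" using assms(2) cancel by auto
    then have "word_eval K \<phi> [(x, b), (x, \<not> b)] = \<one>\<^bsub>K\<^esub>" by simp
    moreover have "[(x, b), (x, \<not> b)] \<in> words X" using cancel by simp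
    ultimately show ?case using cancel
      by (simp add: app del: word_eval.simps append.simps words_simps(2))
  next
    case (relator u v r)
    then show ?case by (simp add: app assms(3))
  qed auto
qed

theorem presented_group_universal:
  assumes "group K" "\<phi> \<in> X \<rightarrow> carrier K" "\<And>r. r \<in> R \<Longrightarrow> word_eval K \<phi> r = \<one>\<^bsub>K\<^esub>"
  shows "\<exists>f \<in> hom (presented_group X R) K. \<forall>x\<in>X. f (presented_gen X R x) = \<phi> x"
proof -
  interpret group K by fact
  define f where "f A = word_eval K \<phi> (SOME w. w \<in> A)" for A
  have f: "f (word_rel X R `` {w}) = word_eval K \<phi> w" if "w \<in> words X" for w
  proof -
    have "w \<in> word_rel X R `` {w}" using that by (auto intro: word_rel.refl)
    then have "(w, SOME u. u \<in> word_rel X R `` {w}) \<in> word_rel X R"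
      by (metis Image_singleton_iff someI)
    then show ?thesis unfolding f_def using word_eval_word_rel[OF assms] by metis
  qed
  have "f \<in> hom (presented_group X R) K"
  proof (rule homI)
    fix A B
    assume "A \<in> carrier (presented_group X R)"
    then obtain u where u: "u \<in> words X" "A = word_rel X R `` {u}"
      by (auto simp: presented_group_carrier elim: quotientE)
    then show "f A \<in> carrier K" using f word_eval_closed[OF assms(1,2)] by simp
    assume "B \<in> carrier (presented_group X R)"
    then obtain v where v: "v \<in> words X" "B = word_rel X R `` {v}"
      by (auto simp: presented_group_carrier elim: quotientE)
    show "f (A \<otimes>\<^bsub>presented_group X R\<^esub> B) = f A \<otimes>\<^bsub>K\<^esub> f B"
      using u v by (simp add: presented_group_mult_class f word_eval_append[OF assms(1,2)])
  qed
  moreover have "f (presented_gen X R x) = \<phi> x" if "x \<in> X" for x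
  proof -
    have "\<phi> x \<in> carrier K" using assms(2) that by auto
    then show ?thesis
      unfolding presented_gen_def using that f[of "word_gen x"] by (simp add: word_gen_def)
  qed
  ultimately show ?thesis by blast
qed

lemma presented_group_hom_eval:
  assumes "group K" "f \<in> hom (presented_group X R) K" "w \<in> words X"
  shows "f (word_rel X R `` {w}) = word_eval K (\<lambda>x. f (presented_gen X R x)) w"
proof -
  interpret P: group "presented_group X R" by (rule group_presented_group)
  interpret group_hom "presented_group X R" K f
    using assms by (simp add: group_hom_def group_hom_axioms_def group_presented_group)
  show ?thesis using assms(3)
  proof (induction w)
    case Nil
    then show ?case using hom_one by (simp add: presented_group_one)
  next
    case (Cons l w)
    obtain x b where l: "l = (x, b)" by force
    have x: "x \<in> X" and w: "w \<in> words X" using Cons.prems l by auto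
    have "word_rel X R `` {[(x, False)]} \<otimes>\<^bsub>presented_group X R\<^esub> presented_gen X R x
        = \<one>\<^bsub>presented_group X R\<^esub>"
      using x word_rel_inv[of "word_gen x" X R]
      by (simp add: presented_gen_def presented_group_mult_class presented_group_one class_eq_iff
          word_inv_def word_gen_def)
    then have i: "word_rel X R `` {[(x, False)]} = inv\<^bsub>presented_group X R\<^esub> presented_gen X R x"
      using x by (intro P.inv_equality[symmetric])
        (auto simp: presented_gen_def presented_group_carrier intro: quotientI)
    have "f (word_rel X R `` {[l]}) =
        (if b then f (presented_gen X R x) else inv\<^bsub>K\<^esub> f (presented_gen X R x))"
    proof (cases b)
      case True
      then show ?thesis using l by (simp add: presented_gen_def word_gen_def)
    next
      case False
      then show ?thesis using l i hom_inv[OF presented_gen_closed[OF x]] by simp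
    qed
    moreover have "word_rel X R `` {l # w}
        = word_rel X R `` {[l]} \<otimes>\<^bsub>presented_group X R\<^esub> word_rel X R `` {w}"
      using Cons.prems by (simp add: presented_group_mult_class)
    moreover have "word_rel X R `` {[l]} \<in> carrier (presented_group X R)"
        "word_rel X R `` {w} \<in> carrier (presented_group X R)"
      using Cons.prems by (auto simp: presented_group_carrier intro: quotientI)
    ultimately show ?case using Cons.IH w l by simp
  qed
qed

theorem presented_group_hom_unique:
  assumes "group K" "f \<in> hom (presented_group X R) K" "f' \<in> hom (presented_group X R) K"
    and "\<And>x. x \<in> X \<Longrightarrow> f (presented_gen X R x) = f' (presented_gen X R x)"
    and "A \<in> carrier (presented_group X R)"
  shows "f A = f' A"
proof -
  obtain w where w: "w \<in> words X" "A = word_rel X R `` {w}"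
    using assms(5) by (auto simp: presented_group_carrier elim: quotientE)
  have "word_eval K (\<lambda>x. f (presented_gen X R x)) w = word_eval K (\<lambda>x. f' (presented_gen X R x)) w"
    using w(1) assms(4) by (induction w) auto
  then show ?thesis
    using w presented_group_hom_eval[OF assms(1)] assms(2,3) by metis
qed

theorem presented_group_relator:
  assumes "r \<in> R" "r \<in> words X"
  shows "word_eval (presented_group X R) (presented_gen X R) r = \<one>\<^bsub>presented_group X R\<^esub>"
proof -
  have id_hom: "(\<lambda>A. A) \<in> hom (presented_group X R) (presented_group X R)"
    by (simp add: hom_def Pi_iff monoid.m_closed[OF group.is_monoid[OF group_presented_group]])
  have "word_eval (presented_group X R) (presented_gen X R) r = word_rel X R `` {r}"
    using presented_group_hom_eval[OF group_presented_group id_hom assms(2)] by simp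
  also have "\<dots> = word_rel X R `` {[]}"
    using word_rel.relator[of "[]" X "[]" r R] assms by (simp add: class_eq_iff)
  finally show ?thesis by (simp add: presented_group_one)
qed


section \<open>Fundamental groups of Seifert manifolds\<close>

datatype seifert_type = o1 | o2 | n1 | n2 | n3 | n4

definition orientable_base :: "seifert_type \<Rightarrow> bool" where
  "orientable_base eps \<longleftrightarrow> eps \<in> {o1, o2}"

fun min_genus :: "seifert_type \<Rightarrow> nat" where
  "min_genus o1 = 0"
| "min_genus o2 = 1"
| "min_genus n1 = 1"
| "min_genus n2 = 1"
| "min_genus n3 = 2"
| "min_genus n4 = 3"

fun fibre_sign :: "seifert_type \<Rightarrow> nat \<Rightarrow> int" where
  "fibre_sign o1 j = 1"
| "fibre_sign o2 j = - 1"
| "fibre_sign n1 j = 1"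
| "fibre_sign n2 j = - 1"
| "fibre_sign n3 j = (if j = 1 then 1 else - 1)"
| "fibre_sign n4 j = (if j = 1 \<or> j = 2 then 1 else - 1)"

text \<open>
  The list \<open>{e; (eps, g); (a 1, b 1), \<dots>, (a n, b n)}\<close>: only the values of \<open>a\<close> and \<open>b\<close> on
  \<open>{1..n}\<close> matter, and the integer \<open>e\<close> is unconstrained.
\<close>

definition seifert_invariants ::
  "seifert_type \<Rightarrow> nat \<Rightarrow> nat \<Rightarrow> (nat \<Rightarrow> int) \<Rightarrow> (nat \<Rightarrow> int) \<Rightarrow> bool" where
  "seifert_invariants eps g n a b \<longleftrightarrow>
     min_genus eps \<le> g \<and> (\<forall>k\<in>{1..n}. coprime (a k) (b k) \<and> a k \<noteq> 0)"

datatype seifert_gen = gen_s nat | gen_v nat | gen_h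

abbreviation s_word :: "nat \<Rightarrow> seifert_gen word" where "s_word k \<equiv> word_gen (gen_s k)"
abbreviation v_word :: "nat \<Rightarrow> seifert_gen word" where "v_word j \<equiv> word_gen (gen_v j)"
abbreviation h_word :: "seifert_gen word" where "h_word \<equiv> word_gen gen_h"

definition num_v :: "seifert_type \<Rightarrow> nat \<Rightarrow> nat" where
  "num_v eps g = (if orientable_base eps then 2 * g else g)"

definition surface_word :: "seifert_type \<Rightarrow> nat \<Rightarrow> seifert_gen word" where
  "surface_word eps g =
     (if orientable_base eps
      then concat (map (\<lambda>i. word_comm (v_word (2 * i - 1)) (v_word (2 * i))) [1..<Suc g])
      else concat (map (\<lambda>j. word_pow (v_word j) 2) [1..<Suc g]))"

definition seifert_gens :: "seifert_type \<Rightarrow> nat \<Rightarrow> nat \<Rightarrow> seifert_gen set" where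
  "seifert_gens eps g n = gen_s ` {1..n} \<union> gen_v ` {1..num_v eps g} \<union> {gen_h}"

definition seifert_relators ::
  "int \<Rightarrow> seifert_type \<Rightarrow> nat \<Rightarrow> nat \<Rightarrow> (nat \<Rightarrow> int) \<Rightarrow> (nat \<Rightarrow> int) \<Rightarrow> seifert_gen word set" where
  "seifert_relators e eps g n a b =
     (\<lambda>k. word_comm (s_word k) h_word) ` {1..n} \<union>
     (\<lambda>k. word_pow (s_word k) (a k) @ word_pow h_word (b k)) ` {1..n} \<union>
     (\<lambda>j. v_word j @ h_word @ word_inv (v_word j) @ word_pow h_word (- fibre_sign eps j))
        ` {1..num_v eps g} \<union>
     {word_pow h_word (- e) @ concat (map s_word [1..<Suc n]) @ surface_word eps g}"

lemma seifert_gens_simps [simp]: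
  "gen_s k \<in> seifert_gens eps g n \<longleftrightarrow> 1 \<le> k \<and> k \<le> n"
  "gen_v j \<in> seifert_gens eps g n \<longleftrightarrow> 1 \<le> j \<and> j \<le> num_v eps g"
  "gen_h \<in> seifert_gens eps g n"
  by (auto simp: seifert_gens_def)

lemma seifert_relators_words: "seifert_relators e eps g n a b \<subseteq> words (seifert_gens eps g n)"
proof -
  have "surface_word eps g \<in> words (seifert_gens eps g n)"
    unfolding surface_word_def
    by (auto simp: num_v_def simp del: upt_Suc intro!: concat_in_words word_pow_in_words) arith+
  moreover have "concat (map s_word [1..<Suc n]) \<in> words (seifert_gens eps g n)"
    by (rule concat_in_words) auto
  ultimately show ?thesis
    unfolding seifert_relators_def
    by (auto intro!: word_pow_in_words)
qed

definition seifert_group ::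
  "int \<Rightarrow> seifert_type \<Rightarrow> nat \<Rightarrow> nat \<Rightarrow> (nat \<Rightarrow> int) \<Rightarrow> (nat \<Rightarrow> int) \<Rightarrow> seifert_gen word set monoid" where
  "seifert_group e eps g n a b =
     presented_group (seifert_gens eps g n) (seifert_relators e eps g n a b)"

definition seifert_elem ::
  "int \<Rightarrow> seifert_type \<Rightarrow> nat \<Rightarrow> nat \<Rightarrow> (nat \<Rightarrow> int) \<Rightarrow> (nat \<Rightarrow> int) \<Rightarrow> seifert_gen \<Rightarrow> seifert_gen word set" where
  "seifert_elem e eps g n a b =
     presented_gen (seifert_gens eps g n) (seifert_relators e eps g n a b)"

end

theory Submission
  imports Defs
begin

text \<open>
The two morphisms agree on the fibre \<open>h\<close> and on every \<open>s\<^sub>k\<close>, so they differ only in the parities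
of the \<open>v\<^sub>j\<close>, and they are odd on \<open>s\<^sub>1\<close>. Dragging the exceptional fibre \<open>s\<^sub>1\<close> through the handle
or crosscap of \<open>v\<^sub>j\<close> multiplies \<open>v\<^sub>j\<close> by a conjugate of \<open>s\<^sub>1\<close> or of its inverse, replaces \<open>s\<^sub>1\<close> by
such a conjugate and fixes the other generators; hence it changes the parity of \<open>v\<^sub>j\<close> and nothing
else. If the loop travelled reverses the orientation of the total space, then
\<open>s\<^sub>1\<close> satisfies the relation with \<open>- b\<^sub>1\<close> in place of \<open>b\<^sub>1\<close> afterwards. So the move is an isomorphism
onto the group with \<open>b\<^sub>1\<close> replaced by \<open>\<plusminus> b\<^sub>1\<close> (\<open>push_factor_solves\<close>, \<open>change_parity\<close>). After one move
for each odd \<open>v\<^sub>j\<close>, both kernels are isomorphic to kernels of morphisms that vanish on all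
\<open>v\<^sub>j\<close> (\<open>clear_parities\<close>). If the total space is orientable, the sign of \<open>b\<^sub>1\<close> never changes
and these two morphisms are equal.

If the total space is non-orientable, the two groups may differ in the sign of \<open>b\<^sub>1\<close>,
and what remains is an isomorphism between the kernels of the parity that vanishes on all \<open>v\<^sub>j\<close>,
taken in the group for \<open>b\<^sub>1\<close> and in the group for \<open>- b\<^sub>1\<close> (\<open>flip_cone_sign\<close>). It comes from the double
cover of the base: a single cone point, with loop \<open>s\<^sub>1\<^sup>2\<close>, lies above the first one, since \<open>s\<^sub>1\<close>
is odd, but the handle or crosscap of \<open>v\<^sub>1\<close> has two lifts. Dragging that cone point through
one of them along an orientation-reversing loop changes the sign of \<open>b\<^sub>1\<close> and
nothing else. This map is not equivariant under the covering involution and need not extend to the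
whole groups.

A presentation of the kernel is never computed. A homomorphism from a subgroup of index two to a
group \<open>K\<close> is the same thing, up to conjugacy, as a homomorphism from the whole group to the wreath
product of \<open>K\<close> with \<open>\<int>/2\<close> lying over the parity, and the latter can be prescribed on the
generators. Both moves thus become substitutions into solutions of the Seifert relations in
an arbitrary group, the first in the Seifert group itself and the second in a wreath product, and
the same identities between words in three letters (\<open>shift_block\<close>, \<open>shift_inverse\<close>) serve for both.
\<close>

section \<open>Evaluation of words\<close>

lemma word_eval_cong:
  assumes "\<And>x. x \<in> fst ` set w \<Longrightarrow> \<phi> x = \<psi> x"
  shows "word_eval K \<phi> w = word_eval K \<psi> w"
  using assms by (induction w) auto

lemma words_iff_letters: "w \<in> words X \<longleftrightarrow> fst ` set w \<subseteq> X"
  by (induction w) auto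

context group
begin

lemma word_eval_word_inv:
  assumes "\<phi> \<in> X \<rightarrow> carrier G" "w \<in> words X"
  shows "word_eval G \<phi> (word_inv w) = inv (word_eval G \<phi> w)"
  using assms(2)
proof (induction w)
  case Nil
  then show ?case by (simp add: word_inv_def)
next
  case (Cons l w)
  obtain x b where l: "l = (x, b)" by force
  have x: "\<phi> x \<in> carrier G" using assms(1) Cons.prems l by auto
  have w: "word_eval G \<phi> w \<in> carrier G"
    using word_eval_closed[OF is_group assms(1)] Cons.prems by simp
  have "word_eval G \<phi> (word_inv (l # w)) = word_eval G \<phi> (word_inv w @ [(x, \<not> b)])"
    using l by (simp add: word_inv_def)
  also have "\<dots> = inv (word_eval G \<phi> w) \<otimes> word_eval G \<phi> [(x, \<not> b)]"
    using word_eval_append[OF is_group assms(1), of "word_inv w" "[(x, \<not> b)]"] Cons l by simp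
  finally show ?case using x w l by (simp add: inv_mult_group)
qed

lemma word_eval_word_pow:
  assumes "\<phi> \<in> X \<rightarrow> carrier G" "w \<in> words X"
  shows "word_eval G \<phi> (word_pow w k) = word_eval G \<phi> w [^] k"
proof -
  have w: "word_eval G \<phi> w \<in> carrier G"
    using word_eval_closed[OF is_group assms] .
  have rep: "word_eval G \<phi> (concat (replicate n u)) = word_eval G \<phi> u [^] n"
    if "u \<in> words X" for u n
  proof (induction n)
    case (Suc n)
    have "concat (replicate n u) \<in> words X" using that by (intro concat_in_words) auto
    then show ?case
      using Suc that word_eval_closed[OF is_group assms(1) that] nat_pow_Suc2[of "word_eval G \<phi> u" n]
      by (simp add: word_eval_append[OF is_group assms(1)])
  qed simp
  show ?thesis
  proof (cases "0 \<le> k")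
    case True
    then have "word_pow w k = concat (replicate (nat k) w)" by (simp add: word_pow_def)
    then have "word_eval G \<phi> (word_pow w k) = word_eval G \<phi> w [^] nat k"
      by (simp only: rep[OF assms(2)])
    also have "\<dots> = word_eval G \<phi> w [^] k" 
      using int_pow_int[of G "word_eval G \<phi> w" "nat k"] True by simp
    finally show ?thesis .
  next
    case False
    then have "word_eval G \<phi> (word_pow w k) = inv (word_eval G \<phi> w) [^] nat (- k)"
      using rep[of "word_inv w" "nat (- k)"] assms(2) word_eval_word_inv[OF assms]
      unfolding word_pow_def by simp
    also have "\<dots> = inv (word_eval G \<phi> w) [^] (- k)"
      using int_pow_int[of G "inv (word_eval G \<phi> w)" "nat (- k)"] False by simp
    also have "\<dots> = word_eval G \<phi> w [^] k"
      using w by (simp add: int_pow_inv int_pow_neg)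
    finally show ?thesis .
  qed
qed

lemma inv_cancel_left [simp]:
  "x \<in> carrier G \<Longrightarrow> z \<in> carrier G \<Longrightarrow> inv x \<otimes> (x \<otimes> z) = z"
  "x \<in> carrier G \<Longrightarrow> z \<in> carrier G \<Longrightarrow> x \<otimes> (inv x \<otimes> z) = z"
  by (simp_all add: m_assoc[symmetric])

lemma mult_inv_eq_one_iff:
  "x \<in> carrier G \<Longrightarrow> z \<in> carrier G \<Longrightarrow> x \<otimes> inv z = \<one> \<longleftrightarrow> x = z"
  by (metis inv_equality inv_inv inv_closed r_inv)

lemma conj_int_pow:
  assumes "z \<in> carrier G" "t \<in> carrier G"
  shows "(z \<otimes> t \<otimes> inv z) [^] (k::int) = z \<otimes> t [^] k \<otimes> inv z"
proof -
  have "(\<lambda>u. z \<otimes> u \<otimes> inv z) \<in> hom G G"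
    using assms(1) by (intro homI) (simp_all add: m_assoc)
  from hom_int_pow[OF this assms(2) is_group is_group] show ?thesis by simp
qed

end

section \<open>Action on the fibre by conjugation\<close>

text \<open>
In a Seifert group every generator conjugates the fibre \<open>h\<close> to \<open>h\<close> or to its inverse. The sign is
part of the relation rather than a function of \<open>z\<close>, because it is not determined when \<open>h\<^sup>2 = 1\<close>.
\<close>
definition conj_acts :: "('a, 'm) monoid_scheme \<Rightarrow> 'a \<Rightarrow> 'a \<Rightarrow> int \<Rightarrow> bool" where
  "conj_acts K h z \<zeta> \<longleftrightarrow> z \<in> carrier K \<and> (\<zeta> = 1 \<or> \<zeta> = - 1) \<and>
     z \<otimes>\<^bsub>K\<^esub> h \<otimes>\<^bsub>K\<^esub> inv\<^bsub>K\<^esub> z = h [^]\<^bsub>K\<^esub> \<zeta>"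

context group
begin

lemma conj_acts_pow:
  assumes "h \<in> carrier G" "conj_acts G h z \<zeta>"
  shows "z \<otimes> h [^] (k::int) \<otimes> inv z = h [^] (\<zeta> * k)"
  using assms by (simp add: conj_acts_def conj_int_pow[symmetric] int_pow_pow)

lemma conj_acts_mult:
  assumes "h \<in> carrier G" "conj_acts G h z \<zeta>" "conj_acts G h w \<xi>"
  shows "conj_acts G h (z \<otimes> w) (\<zeta> * \<xi>)"
proof -
  have c: "z \<in> carrier G" "w \<in> carrier G" using assms by (auto simp: conj_acts_def)
  have "(z \<otimes> w) \<otimes> h \<otimes> inv (z \<otimes> w) = z \<otimes> (w \<otimes> h \<otimes> inv w) \<otimes> inv z"
    using c assms(1) by (simp add: m_assoc inv_mult_group)
  also have "\<dots> = h [^] (\<zeta> * \<xi>)"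
    using assms(3) conj_acts_pow[OF assms(1,2)] by (simp add: conj_acts_def)
  finally show ?thesis using assms by (auto simp: conj_acts_def)
qed

lemma conj_acts_inv:
  assumes "h \<in> carrier G" "conj_acts G h z \<zeta>"
  shows "conj_acts G h (inv z) \<zeta>"
proof -
  have z: "z \<in> carrier G" "\<zeta> * \<zeta> = 1" using assms by (auto simp: conj_acts_def)
  have "inv z \<otimes> h \<otimes> z = inv z \<otimes> (z \<otimes> h [^] \<zeta> \<otimes> inv z) \<otimes> z"
    using conj_acts_pow[OF assms, of \<zeta>] z assms(1) by simp
  also have "\<dots> = h [^] \<zeta>" using z assms(1) by (simp add: m_assoc)
  finally show ?thesis using assms z by (auto simp: conj_acts_def)
qed

lemma conj_acts_1_iff:
  assumes "h \<in> carrier G"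
  shows "conj_acts G h z 1 \<longleftrightarrow> z \<in> carrier G \<and> z \<otimes> h = h \<otimes> z"
proof -
  have "z \<otimes> h \<otimes> inv z = h \<longleftrightarrow> z \<otimes> h = h \<otimes> z" if "z \<in> carrier G"
    using that assms by (metis inv_solve_right m_closed)
  then show ?thesis using assms by (auto simp: conj_acts_def)
qed

lemma conj_acts_carrier: "conj_acts G h z \<zeta> \<Longrightarrow> z \<in> carrier G"
  by (simp add: conj_acts_def)

lemma conj_acts_one: "h \<in> carrier G \<Longrightarrow> conj_acts G h \<one> 1"
  by (simp add: conj_acts_1_iff)

lemma conj_acts_self: "h \<in> carrier G \<Longrightarrow> conj_acts G h h 1"
  by (simp add: conj_acts_1_iff)

lemma conj_acts_word_eval:
  assumes "h \<in> carrier G" "w \<in> words X" "\<And>x. x \<in> X \<Longrightarrow> \<exists>\<zeta>. conj_acts G h (\<phi> x) \<zeta>"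
  shows "\<exists>\<zeta>. conj_acts G h (word_eval G \<phi> w) \<zeta>"
  using assms(2)
proof (induction w)
  case Nil
  then show ?case using conj_acts_one[OF assms(1)] by auto
next
  case (Cons l w)
  then obtain \<zeta> \<xi> where "conj_acts G h (\<phi> (fst l)) \<zeta>" "conj_acts G h (word_eval G \<phi> w) \<xi>"
    using assms(3) by auto blast
  then have "conj_acts G h (word_eval G \<phi> (l # w)) (\<zeta> * \<xi>)"
    using conj_acts_mult[OF assms(1)] conj_acts_inv[OF assms(1)] by simp
  then show ?case ..
qed

lemma conj_acts_word_eval_1:
  assumes "h \<in> carrier G" "w \<in> words X" "\<And>x. x \<in> X \<Longrightarrow> conj_acts G h (\<phi> x) 1"
  shows "conj_acts G h (word_eval G \<phi> w) 1"
  using assms(2)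
proof (induction w)
  case Nil
  then show ?case using conj_acts_one[OF assms(1)] by auto
next
  case (Cons l w)
  then show ?case
    using assms(3) conj_acts_mult[OF assms(1), of _ 1 _ 1] conj_acts_inv[OF assms(1), of _ 1] by auto
qed

lemma conj_acts_int_pow:
  assumes "h \<in> carrier G" "conj_acts G h t 1"
  shows "conj_acts G h (t [^] (\<eta>::int)) 1"
proof -
  have t: "t \<in> carrier G" using assms(2) by (rule conj_acts_carrier)
  have "h \<otimes> t \<otimes> inv h = t"
    using assms t by (simp add: conj_acts_1_iff) (metis inv_solve_right m_closed)
  then have "h \<otimes> t [^] \<eta> \<otimes> inv h = t [^] \<eta>"
    using conj_int_pow[OF assms(1) t, of \<eta>] by simp
  then have "h \<otimes> t [^] \<eta> = t [^] \<eta> \<otimes> h"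
    using assms(1) t by (metis int_pow_closed inv_solve_right m_closed)
  then show ?thesis using assms(1) t by (simp add: conj_acts_1_iff)
qed

lemma conjugate_commutes:
  assumes "h \<in> carrier G" "conj_acts G h t 1" "conj_acts G h z \<zeta>"
  shows "conj_acts G h (z \<otimes> t [^] (\<eta>::int) \<otimes> inv z) 1"
proof -
  have "conj_acts G h (z \<otimes> t [^] \<eta> \<otimes> inv z) (\<zeta> * 1 * \<zeta>)"
    by (intro conj_acts_mult conj_acts_int_pow conj_acts_inv assms)
  moreover have "\<zeta> * 1 * \<zeta> = 1" using assms(3) by (auto simp: conj_acts_def)
  ultimately show ?thesis by (simp only:)
qed

text \<open>
A push replaces the loop \<open>t\<close> by \<open>z t z\<^sup>-\<^sup>1\<close> or by \<open>z t\<^sup>-\<^sup>1 z\<^sup>-\<^sup>1\<close>, so \<open>\<eta>\<close> is \<open>1\<close> or \<open>- 1\<close>, and \<open>\<zeta> \<eta>\<close> is the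
factor by which the invariant \<open>b\<close> changes.
\<close>
lemma conjugate_cone_relation:
  assumes "h \<in> carrier G" "t \<in> carrier G" "conj_acts G h z \<zeta>"
    and rel: "t [^] (k::int) \<otimes> h [^] (b::int) = \<one>"
  shows "(z \<otimes> t [^] \<eta> \<otimes> inv z) [^] k \<otimes> h [^] (\<zeta> * \<eta> * b) = \<one>"
proof -
  have z: "z \<in> carrier G" using assms(3) by (rule conj_acts_carrier)
  have "t [^] k = inv (h [^] b)"
    using rel assms(1,2) by (simp add: inv_equality inv_inv)
  then have "t [^] k = h [^] (- b)" using assms(1) by (simp add: int_pow_neg)
  then have tk: "t [^] (\<eta> * k) = h [^] (- b * \<eta>)"
    using assms(1,2) by (metis int_pow_pow mult.commute)
  have "(z \<otimes> t [^] \<eta> \<otimes> inv z) [^] k \<otimes> h [^] (\<zeta> * \<eta> * b)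
      = (z \<otimes> t [^] (\<eta> * k) \<otimes> inv z) \<otimes> (z \<otimes> h [^] (\<eta> * b) \<otimes> inv z)"
    using conj_acts_pow[OF assms(1,3), of "\<eta> * b"] assms(2) z
    by (simp add: conj_int_pow int_pow_pow mult.assoc)
  also have "\<dots> = z \<otimes> (h [^] (- b * \<eta>) \<otimes> h [^] (\<eta> * b)) \<otimes> inv z"
    using z assms(1) by (simp add: tk m_assoc)
  also have "\<dots> = \<one>"
    using z assms(1) by (simp add: int_pow_mult[symmetric] mult.commute)
  finally show ?thesis .
qed

end

section \<open>Pushing a loop through a handle or a crosscap\<close>

text \<open>
Let \<open>t\<close> be a loop around a cone point that stands directly before the block of a handle or of a
crosscap in the long relator. Pushing the cone point through it multiplies the letter
\<open>x\<close> of the block by a \<open>shift\<close> and leaves the other letter \<open>y\<close> of a handle alone. As the product of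
\<open>t\<close> with the block is unchanged, the new loop is determined; it is a conjugate of \<open>t\<close> or,
for a crosscap, of \<open>inv t\<close>, and \<open>carry\<close> is the conjugating path. The Boolean distinguishes the push
from its inverse, whose formulas come from solving \<open>x' = shift x\<close> for \<open>x\<close> and writing the old loop in
terms of the new one. A crosscap ignores \<open>y\<close>.
\<close>
datatype passage = Handle_fst | Handle_snd | Crosscap

fun block :: "('a, 'm) monoid_scheme \<Rightarrow> passage \<Rightarrow> 'a \<Rightarrow> 'a \<Rightarrow> 'a" (\<open>block\<index>\<close>) where
  "block\<^bsub>G\<^esub> Handle_fst x y = x \<otimes>\<^bsub>G\<^esub> y \<otimes>\<^bsub>G\<^esub> inv\<^bsub>G\<^esub> x \<otimes>\<^bsub>G\<^esub> inv\<^bsub>G\<^esub> y"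
| "block\<^bsub>G\<^esub> Handle_snd x y = y \<otimes>\<^bsub>G\<^esub> x \<otimes>\<^bsub>G\<^esub> inv\<^bsub>G\<^esub> y \<otimes>\<^bsub>G\<^esub> inv\<^bsub>G\<^esub> x"
| "block\<^bsub>G\<^esub> Crosscap x y = x \<otimes>\<^bsub>G\<^esub> x"

fun shift :: "('a, 'm) monoid_scheme \<Rightarrow> passage \<Rightarrow> bool \<Rightarrow> 'a \<Rightarrow> 'a \<Rightarrow> 'a \<Rightarrow> 'a" (\<open>shift\<index>\<close>) where
  "shift\<^bsub>G\<^esub> Handle_fst True t x y = t"
| "shift\<^bsub>G\<^esub> Handle_fst False t x y =
     inv\<^bsub>G\<^esub> (x \<otimes>\<^bsub>G\<^esub> y \<otimes>\<^bsub>G\<^esub> inv\<^bsub>G\<^esub> x) \<otimes>\<^bsub>G\<^esub> inv\<^bsub>G\<^esub> t \<otimes>\<^bsub>G\<^esub> (x \<otimes>\<^bsub>G\<^esub> y \<otimes>\<^bsub>G\<^esub> inv\<^bsub>G\<^esub> x)"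
| "shift\<^bsub>G\<^esub> Handle_snd True t x y = inv\<^bsub>G\<^esub> y \<otimes>\<^bsub>G\<^esub> t \<otimes>\<^bsub>G\<^esub> y"
| "shift\<^bsub>G\<^esub> Handle_snd False t x y =
     inv\<^bsub>G\<^esub> (block\<^bsub>G\<^esub> Handle_snd x y) \<otimes>\<^bsub>G\<^esub> inv\<^bsub>G\<^esub> t \<otimes>\<^bsub>G\<^esub> block\<^bsub>G\<^esub> Handle_snd x y"
| "shift\<^bsub>G\<^esub> Crosscap True t x y = t"
| "shift\<^bsub>G\<^esub> Crosscap False t x y = inv\<^bsub>G\<^esub> x \<otimes>\<^bsub>G\<^esub> t \<otimes>\<^bsub>G\<^esub> x"

fun carry :: "('a, 'm) monoid_scheme \<Rightarrow> passage \<Rightarrow> bool \<Rightarrow> 'a \<Rightarrow> 'a \<Rightarrow> 'a \<Rightarrow> 'a" (\<open>carry\<index>\<close>) where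
  "carry\<^bsub>G\<^esub> Handle_fst True t x y = t \<otimes>\<^bsub>G\<^esub> x \<otimes>\<^bsub>G\<^esub> y \<otimes>\<^bsub>G\<^esub> inv\<^bsub>G\<^esub> (t \<otimes>\<^bsub>G\<^esub> x)"
| "carry\<^bsub>G\<^esub> Handle_fst False t x y = inv\<^bsub>G\<^esub> (x \<otimes>\<^bsub>G\<^esub> y \<otimes>\<^bsub>G\<^esub> inv\<^bsub>G\<^esub> x)"
| "carry\<^bsub>G\<^esub> Handle_snd True t x y =
     block\<^bsub>G\<^esub> Handle_snd (inv\<^bsub>G\<^esub> y \<otimes>\<^bsub>G\<^esub> t \<otimes>\<^bsub>G\<^esub> y \<otimes>\<^bsub>G\<^esub> x) y \<otimes>\<^bsub>G\<^esub> inv\<^bsub>G\<^esub> y"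
| "carry\<^bsub>G\<^esub> Handle_snd False t x y = y \<otimes>\<^bsub>G\<^esub> inv\<^bsub>G\<^esub> (block\<^bsub>G\<^esub> Handle_snd x y)"
| "carry\<^bsub>G\<^esub> Crosscap True t x y = t \<otimes>\<^bsub>G\<^esub> x"
| "carry\<^bsub>G\<^esub> Crosscap False t x y = inv\<^bsub>G\<^esub> x"

definition flip :: "passage \<Rightarrow> int" where
  "flip \<kappa> = (if \<kappa> = Crosscap then - 1 else 1)"

context group
begin

lemma block_closed [simp]: "x \<in> carrier G \<Longrightarrow> y \<in> carrier G \<Longrightarrow> block \<kappa> x y \<in> carrier G"
  by (cases \<kappa>) auto

lemma shift_closed [simp]:
  "t \<in> carrier G \<Longrightarrow> x \<in> carrier G \<Longrightarrow> y \<in> carrier G \<Longrightarrow> shift \<kappa> d t x y \<in> carrier G"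
  by (cases \<kappa>; cases d) auto

lemma carry_closed [simp]:
  "t \<in> carrier G \<Longrightarrow> x \<in> carrier G \<Longrightarrow> y \<in> carrier G \<Longrightarrow> carry \<kappa> d t x y \<in> carrier G"
  by (cases \<kappa>; cases d) auto

lemma int_pow_flip:
  "t \<in> carrier G \<Longrightarrow> t [^] flip \<kappa> = (if \<kappa> = Crosscap then inv t else t)"
  by (simp add: flip_def int_pow_neg)

text \<open>
The left-hand side is the loop \<open>t'\<close> with \<open>t' D' = t D\<close>, where \<open>D\<close> and \<open>D'\<close> are the block before and
after the push.
\<close>
lemma shift_block:
  assumes "t \<in> carrier G" "x \<in> carrier G" "y \<in> carrier G"
  shows "t \<otimes> block \<kappa> x y \<otimes> inv (block \<kappa> (shift \<kappa> d t x y \<otimes> x) y)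
    = carry \<kappa> d t x y \<otimes> t [^] flip \<kappa> \<otimes> inv (carry \<kappa> d t x y)"
  using assms by (cases \<kappa>; cases d) (simp_all add: int_pow_flip m_assoc inv_mult_group)

lemma shift_inverse:
  assumes "t \<in> carrier G" "x \<in> carrier G" "y \<in> carrier G"
    and "x' = shift \<kappa> d t x y \<otimes> x" "t' = carry \<kappa> d t x y \<otimes> t [^] flip \<kappa> \<otimes> inv (carry \<kappa> d t x y)"
  shows "shift \<kappa> (\<not> d) t' x' y \<otimes> shift \<kappa> d t x y = \<one>"
  using assms by (cases \<kappa>; cases d) (simp_all add: int_pow_flip m_assoc inv_mult_group)

lemma conj_acts_block:
  assumes "h \<in> carrier G" "conj_acts G h x \<xi>" "conj_acts G h y \<upsilon>"
  shows "conj_acts G h (block \<kappa> x y) 1"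
proof -
  have s: "\<xi> * \<upsilon> * \<xi> * \<upsilon> = 1" "\<upsilon> * \<xi> * \<upsilon> * \<xi> = 1" "\<xi> * \<xi> = 1"
    using assms(2,3) by (auto simp: conj_acts_def)
  note act = conj_acts_mult[OF assms(1)] conj_acts_inv[OF assms(1)]
  have "conj_acts G h (block Handle_fst x y) (\<xi> * \<upsilon> * \<xi> * \<upsilon>)"
    unfolding block.simps using assms by (intro act)
  moreover have "conj_acts G h (block Handle_snd x y) (\<upsilon> * \<xi> * \<upsilon> * \<xi>)"
    unfolding block.simps using assms by (intro act)
  moreover have "conj_acts G h (block Crosscap x y) (\<xi> * \<xi>)"
    unfolding block.simps using assms by (intro act)
  ultimately show ?thesis by (cases \<kappa>) (simp_all only: s)
qed

lemma conj_acts_conjugate: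
  assumes "h \<in> carrier G" "conj_acts G h t 1" "conj_acts G h z \<zeta>"
  shows "conj_acts G h (inv z \<otimes> t \<otimes> z) 1"
  using conjugate_commutes[OF assms(1,2) conj_acts_inv[OF assms(1,3)], of 1] assms
  by (auto simp: conj_acts_carrier)

lemma conj_acts_shift:
  assumes "h \<in> carrier G" "conj_acts G h t 1" "conj_acts G h x \<xi>" "conj_acts G h y \<upsilon>"
  shows "conj_acts G h (shift \<kappa> d t x y) 1"
proof (cases \<kappa>; cases d)
  have "conj_acts G h (x \<otimes> y \<otimes> inv x) (\<xi> * \<upsilon> * \<xi>)"
    using assms by (intro conj_acts_mult conj_acts_inv)
  then show "conj_acts G h (shift \<kappa> d t x y) 1" if "\<kappa> = Handle_fst" "\<not> d"
    using that assms conj_acts_conjugate conj_acts_inv by simp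
  show "conj_acts G h (shift \<kappa> d t x y) 1" if "\<kappa> = Handle_snd" "\<not> d"
    using that assms conj_acts_conjugate[OF assms(1) conj_acts_inv[OF assms(1,2)] conj_acts_block[OF assms(1,3,4)]]
    by (simp del: block.simps)
qed (use assms conj_acts_conjugate in simp_all)

text \<open>
The push that changes \<open>x\<close> carries the cone point along a conjugate of \<open>y\<close> or its inverse in a handle,
but along \<open>x\<close> itself in a crosscap.
\<close>
lemma conj_acts_carry:
  assumes "h \<in> carrier G" "conj_acts G h t 1" "conj_acts G h x \<xi>" "conj_acts G h y \<upsilon>"
  shows "conj_acts G h (carry \<kappa> d t x y) (if \<kappa> = Crosscap then \<xi> else \<upsilon>)"
proof -
  have s: "\<xi> * \<xi> = 1" using assms(3) by (auto simp: conj_acts_def)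
  note act = conj_acts_mult[OF assms(1)] conj_acts_inv[OF assms(1)]
  have "conj_acts G h (carry Handle_fst True t x y) (1 * \<xi> * \<upsilon> * (1 * \<xi>))"
    unfolding carry.simps using assms by (intro act)
  moreover have "conj_acts G h (carry Handle_fst False t x y) (\<xi> * \<upsilon> * \<xi>)"
    unfolding carry.simps using assms by (intro act)
  moreover have "conj_acts G h (inv y \<otimes> t \<otimes> y \<otimes> x) (1 * \<xi>)"
    using assms conj_acts_conjugate by (intro act) auto
  then have "conj_acts G h (carry Handle_snd True t x y) (1 * \<upsilon>)"
    unfolding carry.simps using assms by (intro act conj_acts_block)
  moreover have "conj_acts G h (carry Handle_snd False t x y) (\<upsilon> * 1)"
    unfolding carry.simps using assms by (intro act conj_acts_block)
  moreover have "conj_acts G h (carry Crosscap True t x y) (1 * \<xi>)"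
    unfolding carry.simps using assms by (intro act)
  moreover have "conj_acts G h (carry Crosscap False t x y) \<xi>"
    unfolding carry.simps using assms by (intro act)
  ultimately show ?thesis
    using s by (cases \<kappa>; cases d) (simp_all add: mult.commute mult.left_commute)
qed

end

lemma hom_shift:
  assumes "group G" "group H" "F \<in> hom G H" "t \<in> carrier G" "x \<in> carrier G" "y \<in> carrier G"
  shows "F (shift\<^bsub>G\<^esub> \<kappa> d t x y) = shift\<^bsub>H\<^esub> \<kappa> d (F t) (F x) (F y)"
proof -
  interpret group_hom G H F using assms by (simp add: group_hom_def group_hom_axioms_def)
  show ?thesis using assms(4,5,6) by (cases \<kappa>; cases d) simp_all
qed

lemma hom_word_eval:
  assumes "group G" "group H" "F \<in> hom G H" "\<phi> \<in> X \<rightarrow> carrier G" "w \<in> words X"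
  shows "F (word_eval G \<phi> w) = word_eval H (\<lambda>x. F (\<phi> x)) w"
proof -
  interpret group_hom G H F using assms by (simp add: group_hom_def group_hom_axioms_def)
  have [simp]: "word_eval G \<phi> w \<in> carrier G" if "w \<in> words X" for w
    using word_eval_closed[OF assms(1,4) that] .
  show ?thesis using assms(4,5) by (induction w) (auto simp: Pi_iff)
qed

section \<open>Homomorphisms from subgroups of index two\<close>

text \<open>
The wreath product with \<open>\<int>/2\<close>: the Boolean tells whether the two coordinates are exchanged.
\<close>
definition wreath2 :: "('a, 'm) monoid_scheme \<Rightarrow> ('a \<times> 'a \<times> bool) monoid" where
  "wreath2 H =
     \<lparr>carrier = carrier H \<times> carrier H \<times> UNIV,
      monoid.mult = (\<lambda>(u, v, c) (u', v', c').
        (u \<otimes>\<^bsub>H\<^esub> (if c then v' else u'), v \<otimes>\<^bsub>H\<^esub> (if c then u' else v'), c \<noteq> c')),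
      one = (\<one>\<^bsub>H\<^esub>, \<one>\<^bsub>H\<^esub>, False)\<rparr>"

lemma wreath2_simps [simp]:
  "(u, v, c) \<in> carrier (wreath2 H) \<longleftrightarrow> u \<in> carrier H \<and> v \<in> carrier H"
  "(u, v, c) \<otimes>\<^bsub>wreath2 H\<^esub> (u', v', c') =
     (u \<otimes>\<^bsub>H\<^esub> (if c then v' else u'), v \<otimes>\<^bsub>H\<^esub> (if c then u' else v'), c \<noteq> c')"
  "\<one>\<^bsub>wreath2 H\<^esub> = (\<one>\<^bsub>H\<^esub>, \<one>\<^bsub>H\<^esub>, False)"
  by (simp_all add: wreath2_def)

context group
begin

lemma group_wreath2: "group (wreath2 G)"
proof (rule groupI)
  fix p assume "p \<in> carrier (wreath2 G)"
  then obtain u v c where p: "p = (u, v, c)" "u \<in> carrier G" "v \<in> carrier G"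
    by (cases p) auto
  show "\<exists>q\<in>carrier (wreath2 G). q \<otimes>\<^bsub>wreath2 G\<^esub> p = \<one>\<^bsub>wreath2 G\<^esub>"
    using p by (intro bexI[of _ "(inv (if c then v else u), inv (if c then u else v), c)"]) auto
qed (auto simp: m_assoc split: if_splits)

lemma inv_wreath2 [simp]:
  assumes "u \<in> carrier G" "v \<in> carrier G"
  shows "inv\<^bsub>wreath2 G\<^esub> (u, v, c) = (inv (if c then v else u), inv (if c then u else v), c)"
  using assms by (intro group.inv_equality[OF group_wreath2]) auto

lemma diagonal_hom_wreath2: "(\<lambda>u. (u, u, False)) \<in> hom G (wreath2 G)"
  by (auto intro: homI)

lemma int_pow_diagonal:
  "u \<in> carrier G \<Longrightarrow> (u, u, False) [^]\<^bsub>wreath2 G\<^esub> (k::int) = (u [^] k, u [^] k, False)"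
  using hom_int_pow[OF diagonal_hom_wreath2 _ is_group group_wreath2] by simp

end

definition map_wreath :: "('a \<Rightarrow> 'b) \<Rightarrow> 'a \<times> 'a \<times> bool \<Rightarrow> 'b \<times> 'b \<times> bool" where
  "map_wreath \<psi> = (\<lambda>(u, v, c). (\<psi> u, \<psi> v, c))"

lemma map_wreath_simp [simp]: "map_wreath \<psi> (u, v, c) = (\<psi> u, \<psi> v, c)"
  by (simp add: map_wreath_def)

lemma map_wreath_hom:
  assumes "\<psi> \<in> hom H K"
  shows "map_wreath \<psi> \<in> hom (wreath2 H) (wreath2 K)"
  using assms by (auto intro!: homI simp: hom_def Pi_iff)

text \<open>
The action of \<open>G\<close> by multiplication on itself, seen from the transversal \<open>{1, y}\<close> of
the kernel of the parity \<open>f\<close>: it embeds \<open>G\<close> into the wreath product of that kernel with \<open>\<int>/2\<close>.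
\<close>
definition induced_embedding ::
    "('a, 'm) monoid_scheme \<Rightarrow> ('a \<Rightarrow> int) \<Rightarrow> 'a \<Rightarrow> 'a \<Rightarrow> 'a \<times> 'a \<times> bool" where
  "induced_embedding G f y g =
     (if f g = 0 then (g, y \<otimes>\<^bsub>G\<^esub> g \<otimes>\<^bsub>G\<^esub> inv\<^bsub>G\<^esub> y, False) else (g \<otimes>\<^bsub>G\<^esub> inv\<^bsub>G\<^esub> y, y \<otimes>\<^bsub>G\<^esub> g, True))"

abbreviation (input) parity_group :: "int monoid" where "parity_group \<equiv> integer_mod_group 2"

locale parity = group +
  fixes f :: "'a \<Rightarrow> int"
  assumes parity_hom: "f \<in> hom G parity_group"
begin

abbreviation even_part :: "('a, 'b) monoid_scheme" where
  "even_part \<equiv> G\<lparr>carrier := kernel G parity_group f\<rparr>"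

sublocale parity_group_hom: group_hom G parity_group f
  using parity_hom by (simp add: group_hom_def group_hom_axioms_def)

lemma parity_cases: "x \<in> carrier G \<Longrightarrow> f x = 0 \<or> f x = 1"
  using parity_group_hom.hom_closed[of x] by (auto simp: carrier_integer_mod_group)

lemma parity_mult: "x \<in> carrier G \<Longrightarrow> y \<in> carrier G \<Longrightarrow> f (x \<otimes> y) = (f x + f y) mod 2"
  using parity_group_hom.hom_mult by simp

lemma parity_inv [simp]:
  assumes "x \<in> carrier G"
  shows "f (inv x) = f x"
  using parity_cases[OF assms] parity_group_hom.hom_inv[OF assms] 
  by (auto simp: carrier_integer_mod_group)

lemma parity_int_pow: "x \<in> carrier G \<Longrightarrow> f (x [^] (k::int)) = (k * f x) mod 2"
  using parity_group_hom.hom_int_pow[of x k] by (simp add: int_pow_integer_mod_group)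

lemma mem_kernel: "x \<in> kernel G parity_group f \<longleftrightarrow> x \<in> carrier G \<and> f x = 0"
  by (simp add: kernel_def)

lemma mem_even_part: "x \<in> carrier even_part \<longleftrightarrow> x \<in> carrier G \<and> f x = 0"
  by (simp add: mem_kernel)

lemma even_part_simps [simp]:
  "monoid.mult even_part = monoid.mult G" "\<one>\<^bsub>even_part\<^esub> = \<one>"
  by simp_all

lemma group_even_part: "group even_part"
  using parity_group_hom.subgroup_kernel subgroup.subgroup_is_group is_group by blast

lemma inv_even_part: "x \<in> carrier even_part \<Longrightarrow> inv\<^bsub>even_part\<^esub> x = inv x"
  using m_inv_consistent[OF parity_group_hom.subgroup_kernel, of x] by simp

lemma int_pow_even_part:
  "x \<in> carrier even_part \<Longrightarrow> x [^]\<^bsub>even_part\<^esub> (k::int) = x [^] k"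
  using int_pow_consistent[OF parity_group_hom.subgroup_kernel, of x k] by simp

lemma induced_embedding_hom:
  assumes y: "y \<in> carrier G" "f y = 1"
  shows "induced_embedding G f y \<in> hom G (wreath2 even_part)"
proof (rule homI)
  fix x z assume x: "x \<in> carrier G" and z: "z \<in> carrier G"
  show "induced_embedding G f y x \<in> carrier (wreath2 even_part)"
    using parity_cases[OF x] x y
    by (auto simp: induced_embedding_def mem_kernel parity_mult)
  show "induced_embedding G f y (x \<otimes> z)
      = induced_embedding G f y x \<otimes>\<^bsub>wreath2 even_part\<^esub> induced_embedding G f y z"
    using parity_cases[OF x] parity_cases[OF z] x z y
    by (auto simp: induced_embedding_def parity_mult m_assoc)
qed

text \<open>
A homomorphism to the wreath product that lies over the parity has, on the even elements, a
homomorphism as its first coordinate.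
\<close>
lemma wreath_hom_restrict:
  assumes K: "group K" and T: "\<Theta> \<in> hom G (wreath2 K)"
    and lift: "\<And>x. x \<in> carrier G \<Longrightarrow> snd (snd (\<Theta> x)) \<longleftrightarrow> f x = 1"
  shows "(\<lambda>x. fst (\<Theta> x)) \<in> hom even_part K"
proof (rule homI)
  fix x z assume x: "x \<in> carrier even_part" and z: "z \<in> carrier even_part"
  have "\<Theta> x \<in> carrier (wreath2 K)"
    using T x by (auto simp: hom_def mem_kernel Pi_iff)
  then obtain u v where u: "\<Theta> x = (u, v, False)" "u \<in> carrier K"
    using lift[of x] x unfolding mem_even_part by (cases "\<Theta> x") auto
  then show "fst (\<Theta> x) \<in> carrier K" by simp
  have "\<Theta> (x \<otimes> z) = \<Theta> x \<otimes>\<^bsub>wreath2 K\<^esub> \<Theta> z"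
    using T x z by (auto simp: hom_def mem_kernel)
  then show "fst (\<Theta> (x \<otimes>\<^bsub>even_part\<^esub> z)) = fst (\<Theta> x) \<otimes>\<^bsub>K\<^esub> fst (\<Theta> z)"
    using u by (cases "\<Theta> z") simp
qed

text \<open>
Conversely the first coordinate on the even elements determines the homomorphism, once it is
normalized by sending \<open>y\<close> to an element with trivial first coordinate; for instance the second
coordinate of an even \<open>x\<close> is the first coordinate of \<open>y x y\<^sup>-\<^sup>1\<close>.
\<close>
lemma wreath_hom_induced:
  assumes K: "group K" and T: "\<Theta> \<in> hom G (wreath2 K)"
    and lift: "\<And>x. x \<in> carrier G \<Longrightarrow> snd (snd (\<Theta> x)) \<longleftrightarrow> f x = 1"
    and y: "y \<in> carrier G" "f y = 1" "fst (\<Theta> y) = \<one>\<^bsub>K\<^esub>"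
    and x: "x \<in> carrier G"
  shows "map_wreath (\<lambda>x. fst (\<Theta> x)) (induced_embedding G f y x) = \<Theta> x"
proof -
  interpret K: group K by fact
  interpret T: group_hom G "wreath2 K" \<Theta>
    using T K.group_wreath2 by (simp add: group_hom_def group_hom_axioms_def)
  obtain d where d: "\<Theta> y = (\<one>\<^bsub>K\<^esub>, d, True)" "d \<in> carrier K"
    using lift[OF y(1)] y T.hom_closed[OF y(1)] by (cases "\<Theta> y") auto
  obtain u v c where u: "\<Theta> x = (u, v, c)" "u \<in> carrier K" "v \<in> carrier K"
    using T.hom_closed[OF x] by (cases "\<Theta> x") auto
  have "c \<longleftrightarrow> f x = 1" using lift[OF x] u by simp
  then show ?thesis
    using parity_cases[OF x] x y d u by (auto simp: induced_embedding_def K.m_assoc)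
qed

end

section \<open>Solutions of the Seifert relations in a group\<close>

text \<open>
The invariants \<open>b\<close> are left out of the parameters, because they vary in the proof.
\<close>
locale seifert =
  fixes e :: int and eps :: seifert_type and g n :: nat and a :: "nat \<Rightarrow> int"
  assumes cone_point: "1 \<le> n"
begin

abbreviation gens :: "seifert_gen set" where "gens \<equiv> seifert_gens eps g n"
abbreviation rels :: "(nat \<Rightarrow> int) \<Rightarrow> seifert_gen word set" where
  "rels b \<equiv> seifert_relators e eps g n a b"
abbreviation grp :: "(nat \<Rightarrow> int) \<Rightarrow> seifert_gen word set monoid" where
  "grp b \<equiv> seifert_group e eps g n a b"
abbreviation gen :: "(nat \<Rightarrow> int) \<Rightarrow> seifert_gen \<Rightarrow> seifert_gen word set" where
  "gen b \<equiv> seifert_elem e eps g n a b"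
abbreviation vs :: "nat set" where "vs \<equiv> {1..num_v eps g}"

definition solves :: "('k, 'm) monoid_scheme \<Rightarrow> (nat \<Rightarrow> int) \<Rightarrow> (seifert_gen \<Rightarrow> 'k) \<Rightarrow> bool" where
  "solves K b \<phi> \<longleftrightarrow> \<phi> \<in> gens \<rightarrow> carrier K \<and> (\<forall>r\<in>rels b. word_eval K \<phi> r = \<one>\<^bsub>K\<^esub>)"

lemma group_grp: "group (grp b)"
  by (simp add: seifert_group_def group_presented_group)

lemma gen_closed: "z \<in> gens \<Longrightarrow> gen b z \<in> carrier (grp b)"
  by (simp add: seifert_group_def seifert_elem_def presented_gen_closed)

lemma solves_gen: "solves (grp b) b (gen b)"
  unfolding solves_def
proof (intro conjI ballI Pi_I)
  fix r assume "r \<in> rels b"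
  then show "word_eval (grp b) (gen b) r = \<one>\<^bsub>grp b\<^esub>"
    unfolding seifert_group_def seifert_elem_def
    using subsetD[OF seifert_relators_words] by (intro presented_group_relator)
qed (rule gen_closed)

lemma solves_hom:
  assumes "group K" "solves K b \<phi>"
  obtains F where "F \<in> hom (grp b) K" "\<And>z. z \<in> gens \<Longrightarrow> F (gen b z) = \<phi> z"
  using presented_group_universal[OF assms(1), of \<phi> gens "rels b"] assms(2)
  unfolding solves_def seifert_group_def seifert_elem_def by blast

lemma hom_unique:
  assumes "group K" "F \<in> hom (grp b) K" "F' \<in> hom (grp b) K"
    and "\<And>z. z \<in> gens \<Longrightarrow> F (gen b z) = F' (gen b z)" "x \<in> carrier (grp b)"
  shows "F x = F' x"
  using presented_group_hom_unique[OF assms(1)] assms(2-)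
  unfolding seifert_group_def seifert_elem_def by blast

text \<open>
Only the first exceptional fibre moves, so \<open>s\<^sub>1\<close> is kept apart: the long relator says that
\<open>s\<^sub>1\<close> is \<open>h\<^sup>e\<close> times the inverse of the value of \<open>tail_word\<close>, which does not contain \<open>s\<^sub>1\<close>.
\<close>
definition cones_word :: "seifert_gen word" where
  "cones_word = concat (map s_word [2..<Suc n])"

definition tail_word :: "seifert_gen word" where
  "tail_word = cones_word @ surface_word eps g"

lemma cones_word_letters: "cones_word \<in> words (gen_s ` {2..n})"
  unfolding cones_word_def by (rule concat_in_words) auto

lemma surface_word_letters: "surface_word eps g \<in> words (gen_v ` vs)"
proof -
  have "gen_v i \<in> gen_v ` {1..k} \<longleftrightarrow> 1 \<le> i \<and> i \<le> k" for i k by auto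
  then show ?thesis
    unfolding surface_word_def num_v_def
    by (auto simp del: upt_Suc intro!: concat_in_words word_pow_in_words; arith)
qed

lemma words_mono: "w \<in> words Y \<Longrightarrow> Y \<subseteq> Z \<Longrightarrow> w \<in> words Z"
  by (auto simp: words_iff_letters)

lemma tail_word_letters: "tail_word \<in> words (gens - {gen_s 1})"
proof -
  have "gen_s ` {2..n} \<subseteq> gens - {gen_s 1}" "gen_v ` vs \<subseteq> gens - {gen_s 1}" by auto
  then show ?thesis
    using words_mono[OF cones_word_letters] words_mono[OF surface_word_letters]
    by (simp add: tail_word_def)
qed

lemma tail_word_gens: "tail_word \<in> words gens"
  using words_mono[OF tail_word_letters] by auto

lemma fibre_sign_cases: "fibre_sign eps j = 1 \<or> fibre_sign eps j = - 1"
  by (cases eps) auto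

lemma word_eval_gen:
  assumes "group K" "\<phi> z \<in> carrier K"
  shows "word_eval K \<phi> (word_gen z) = \<phi> z"
  using assms by (simp add: word_gen_def group.is_monoid)

lemma solves_iff:
  assumes "group K" "\<phi> \<in> gens \<rightarrow> carrier K"
  shows "solves K b \<phi> \<longleftrightarrow>
    (\<forall>k\<in>{1..n}. conj_acts K (\<phi> gen_h) (\<phi> (gen_s k)) 1) \<and>
    (\<forall>k\<in>{1..n}. \<phi> (gen_s k) [^]\<^bsub>K\<^esub> a k \<otimes>\<^bsub>K\<^esub> \<phi> gen_h [^]\<^bsub>K\<^esub> b k = \<one>\<^bsub>K\<^esub>) \<and>
    (\<forall>j\<in>vs. conj_acts K (\<phi> gen_h) (\<phi> (gen_v j)) (fibre_sign eps j)) \<and>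
    \<phi> (gen_s 1) = \<phi> gen_h [^]\<^bsub>K\<^esub> e \<otimes>\<^bsub>K\<^esub> inv\<^bsub>K\<^esub> word_eval K \<phi> tail_word"
proof -
  interpret group K by fact
  note ev = word_eval_append[OF is_group assms(2)] word_eval_word_inv[OF assms(2)]
    word_eval_word_pow[OF assms(2)] word_eval_gen[OF is_group] word_eval_closed[OF is_group assms(2)]
  have c: "\<phi> z \<in> carrier K" if "z \<in> gens" for z using assms(2) that by auto
  have h: "\<phi> gen_h \<in> carrier K" using c by simp
  have T: "word_eval K \<phi> tail_word \<in> carrier K" using ev tail_word_gens by blast
  have 1: "word_eval K \<phi> (word_comm (s_word k) h_word) = \<one>\<^bsub>K\<^esub> \<longleftrightarrow>
      conj_acts K (\<phi> gen_h) (\<phi> (gen_s k)) 1" if "k \<in> {1..n}" for k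
  proof -
    have s: "\<phi> (gen_s k) \<in> carrier K" using c that by simp
    have "word_eval K \<phi> (word_comm (s_word k) h_word) =
        (\<phi> (gen_s k) \<otimes>\<^bsub>K\<^esub> \<phi> gen_h) \<otimes>\<^bsub>K\<^esub> inv\<^bsub>K\<^esub> (\<phi> gen_h \<otimes>\<^bsub>K\<^esub> \<phi> (gen_s k))"
      using that s h by (simp add: word_comm_def ev m_assoc inv_mult_group)
    then show ?thesis
      using s h by (simp add: conj_acts_1_iff mult_inv_eq_one_iff)
  qed
  have 2: "word_eval K \<phi> (word_pow (s_word k) (a k) @ word_pow h_word (b k)) =
      \<phi> (gen_s k) [^]\<^bsub>K\<^esub> a k \<otimes>\<^bsub>K\<^esub> \<phi> gen_h [^]\<^bsub>K\<^esub> b k" if "k \<in> {1..n}" for k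
    using that c h by (simp add: ev word_pow_in_words)
  have 3: "word_eval K \<phi> (v_word j @ h_word @ word_inv (v_word j) @ word_pow h_word (- fibre_sign eps j))
        = \<one>\<^bsub>K\<^esub> \<longleftrightarrow> conj_acts K (\<phi> gen_h) (\<phi> (gen_v j)) (fibre_sign eps j)" if "j \<in> vs" for j
  proof -
    have v: "\<phi> (gen_v j) \<in> carrier K" using c that by simp
    have "word_eval K \<phi> (v_word j @ h_word @ word_inv (v_word j) @ word_pow h_word (- fibre_sign eps j))
        = (\<phi> (gen_v j) \<otimes>\<^bsub>K\<^esub> \<phi> gen_h \<otimes>\<^bsub>K\<^esub> inv\<^bsub>K\<^esub> \<phi> (gen_v j)) \<otimes>\<^bsub>K\<^esub>
            inv\<^bsub>K\<^esub> (\<phi> gen_h [^]\<^bsub>K\<^esub> fibre_sign eps j)"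
      using that v h by (simp add: ev word_pow_in_words m_assoc int_pow_neg)
    then show ?thesis
      using v h fibre_sign_cases by (simp add: conj_acts_def mult_inv_eq_one_iff)
  qed
  have "word_pow h_word (- e) @ concat (map s_word [1..<Suc n]) @ surface_word eps g
      = word_pow h_word (- e) @ s_word 1 @ tail_word"
    using cone_point by (simp add: tail_word_def cones_word_def upt_conv_Cons numeral_2_eq_2 del: upt_Suc)
  then have "word_eval K \<phi> (word_pow h_word (- e) @ concat (map s_word [1..<Suc n]) @ surface_word eps g)
      = inv\<^bsub>K\<^esub> (\<phi> gen_h [^]\<^bsub>K\<^esub> e) \<otimes>\<^bsub>K\<^esub> (\<phi> (gen_s 1) \<otimes>\<^bsub>K\<^esub> word_eval K \<phi> tail_word)"
    using h c cone_point tail_word_gens by (simp add: ev word_pow_in_words int_pow_neg)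
  moreover have "inv\<^bsub>K\<^esub> p \<otimes>\<^bsub>K\<^esub> (q \<otimes>\<^bsub>K\<^esub> t) = \<one>\<^bsub>K\<^esub> \<longleftrightarrow> q = p \<otimes>\<^bsub>K\<^esub> inv\<^bsub>K\<^esub> t"
    if "p \<in> carrier K" "q \<in> carrier K" "t \<in> carrier K" for p q t
  proof
    assume "inv\<^bsub>K\<^esub> p \<otimes>\<^bsub>K\<^esub> (q \<otimes>\<^bsub>K\<^esub> t) = \<one>\<^bsub>K\<^esub>"
    then have "inv\<^bsub>K\<^esub> p \<otimes>\<^bsub>K\<^esub> inv\<^bsub>K\<^esub> (inv\<^bsub>K\<^esub> (q \<otimes>\<^bsub>K\<^esub> t)) = \<one>\<^bsub>K\<^esub>" using that by simp
    then have "inv\<^bsub>K\<^esub> p = inv\<^bsub>K\<^esub> (q \<otimes>\<^bsub>K\<^esub> t)" using that by (simp only: mult_inv_eq_one_iff inv_closed m_closed)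
    then have "p = q \<otimes>\<^bsub>K\<^esub> t" using that by (metis inv_inv m_closed)
    then show "q = p \<otimes>\<^bsub>K\<^esub> inv\<^bsub>K\<^esub> t" using that by (auto simp: m_assoc)
  qed (use that in \<open>simp add: m_assoc\<close>)
  moreover have "\<phi> (gen_s 1) \<in> carrier K" using c cone_point by simp
  ultimately have 4: "word_eval K \<phi> (word_pow h_word (- e) @ concat (map s_word [1..<Suc n]) @ surface_word eps g)
      = \<one>\<^bsub>K\<^esub> \<longleftrightarrow> \<phi> (gen_s 1) = \<phi> gen_h [^]\<^bsub>K\<^esub> e \<otimes>\<^bsub>K\<^esub> inv\<^bsub>K\<^esub> word_eval K \<phi> tail_word"
    using T h by simp
  show ?thesis
    unfolding solves_def seifert_relators_def
    by (simp only: ball_Un ball_simps assms(2) simp_thms conj_assoc 4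
        ball_cong[OF HOL.refl 1] ball_cong[OF HOL.refl arg_cong2[where f = "(=)", OF 2 HOL.refl]] ball_cong[OF HOL.refl 3])
qed

end

context seifert
begin

section \<open>Pushing the first cone point in a solution\<close>

text \<open>
The other letter of the handle that contains \<open>v\<^sub>j\<close>. For a crosscap, whose block ignores it, the value
\<open>h\<close> is a placeholder that no push changes.
\<close>
definition mate :: "nat \<Rightarrow> seifert_gen" where
  "mate j = (if orientable_base eps then gen_v (if odd j then j + 1 else j - 1) else gen_h)"

definition passage_of :: "nat \<Rightarrow> passage" where
  "passage_of j =
     (if orientable_base eps then (if odd j then Handle_fst else Handle_snd) else Crosscap)"

text \<open>
The factor by which \<open>b\<^sub>1\<close> is multiplied when the first cone point is pushed through the handle or
crosscap of \<open>v\<^sub>j\<close>: it tells whether the loop travelled preserves the orientation of the total space.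
Over an orientable base this is the sign of \<open>mate j\<close>, but all fibre signs are equal there.
\<close>
definition cone_sign :: "nat \<Rightarrow> int" where
  "cone_sign j = (if orientable_base eps then fibre_sign eps 1 else - fibre_sign eps j)"

definition before_word :: "nat \<Rightarrow> seifert_gen word" where
  "before_word j =
     (if orientable_base eps
      then concat (map (\<lambda>i. word_comm (v_word (2 * i - 1)) (v_word (2 * i))) [1..<(j + 1) div 2])
      else concat (map (\<lambda>j. word_pow (v_word j) 2) [1..<j]))"

definition block_word :: "nat \<Rightarrow> seifert_gen word" where
  "block_word j =
     (if orientable_base eps
      then word_comm (v_word (2 * ((j + 1) div 2) - 1)) (v_word (2 * ((j + 1) div 2)))
      else word_pow (v_word j) 2)"

definition after_word :: "nat \<Rightarrow> seifert_gen word" where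
  "after_word j =
     (if orientable_base eps
      then concat (map (\<lambda>i. word_comm (v_word (2 * i - 1)) (v_word (2 * i))) [Suc ((j + 1) div 2)..<Suc g])
      else concat (map (\<lambda>j. word_pow (v_word j) 2) [Suc j..<Suc g]))"

lemma upt_split: "1 \<le> i \<Longrightarrow> i \<le> k \<Longrightarrow> [1..<Suc k] = [1..<i] @ i # [Suc i..<Suc k]"
  using upt_add_eq_append[of 1 i "Suc k - i"] upt_conv_Cons[of i "Suc k"] by simp

lemma surface_word_split:
  assumes "j \<in> vs"
  shows "surface_word eps g = before_word j @ block_word j @ after_word j"
proof (cases "orientable_base eps")
  case True
  then have "1 \<le> (j + 1) div 2" "(j + 1) div 2 \<le> g" using assms by (auto simp: num_v_def)
  from upt_split[OF this] show ?thesis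
    using True by (simp add: surface_word_def before_word_def block_word_def after_word_def del: upt_Suc)
next
  case False
  then have "1 \<le> j" "j \<le> g" using assms by (auto simp: num_v_def)
  from upt_split[OF this] show ?thesis
    using False by (simp add: surface_word_def before_word_def block_word_def after_word_def del: upt_Suc)
qed

lemma gen_v_mem: "gen_v i \<in> gen_v ` (A - {j}) \<longleftrightarrow> i \<in> A \<and> i \<noteq> j"
  by auto

lemma before_word_letters: "j \<in> vs \<Longrightarrow> before_word j \<in> words (gen_v ` (vs - {j}))"
  unfolding before_word_def
  by (auto simp: gen_v_mem num_v_def simp del: upt_Suc intro!: concat_in_words word_pow_in_words; arith)

lemma after_word_letters: "j \<in> vs \<Longrightarrow> after_word j \<in> words (gen_v ` (vs - {j}))"
  unfolding after_word_def
  by (auto simp: gen_v_mem num_v_def simp del: upt_Suc intro!: concat_in_words word_pow_in_words; arith)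

lemma before_word_1: "before_word 1 = []"
  by (simp add: before_word_def)

lemma mate_gens: "j \<in> vs \<Longrightarrow> mate j \<in> gens - {gen_v j, gen_s 1}"
  by (auto simp: mate_def num_v_def) presburger+

lemma word_eval_block_word:
  assumes "group K" "\<phi> \<in> gens \<rightarrow> carrier K" "j \<in> vs"
  shows "word_eval K \<phi> (block_word j) = block\<^bsub>K\<^esub> (passage_of j) (\<phi> (gen_v j)) (\<phi> (mate j))"
proof -
  interpret group K by fact
  have c: "\<phi> (gen_v j) \<in> carrier K" "\<phi> (mate j) \<in> carrier K"
    using mate_gens[OF assms(3)] assms(2,3) by auto
  show ?thesis
  proof (cases "orientable_base eps")
    case True
    show ?thesis
    proof (cases "odd j")
      case odd: True
      then have "2 * ((j + 1) div 2) = j + 1" by simp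
      then show ?thesis using True odd c
        by (simp add: block_word_def word_comm_def word_inv_def word_gen_def passage_of_def mate_def m_assoc)
    next
      case even: False
      then have "2 * ((j + 1) div 2) = j" by simp
      then show ?thesis using True even c
        by (simp add: block_word_def word_comm_def word_inv_def word_gen_def passage_of_def mate_def m_assoc)
    qed
  next
    case False
    then show ?thesis using c
      by (simp add: block_word_def word_pow_def word_gen_def passage_of_def numeral_2_eq_2)
  qed
qed

text \<open>
Multiply \<open>v\<^sub>j\<close> by \<open>U\<close> and let the long relator dictate the new value of \<open>s\<^sub>1\<close>.
\<close>
definition push :: "('k, 'm) monoid_scheme \<Rightarrow> (seifert_gen \<Rightarrow> 'k) \<Rightarrow> nat \<Rightarrow> 'k \<Rightarrow> seifert_gen \<Rightarrow> 'k" where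
  "push K \<phi> j U =
     (let \<phi>1 = \<phi>(gen_v j := U \<otimes>\<^bsub>K\<^esub> \<phi> (gen_v j))
      in \<phi>1(gen_s 1 := \<phi> gen_h [^]\<^bsub>K\<^esub> e \<otimes>\<^bsub>K\<^esub> inv\<^bsub>K\<^esub> word_eval K \<phi>1 tail_word))"

lemma push_other: "z \<noteq> gen_s 1 \<Longrightarrow> z \<noteq> gen_v j \<Longrightarrow> push K \<phi> j U z = \<phi> z"
  by (simp add: push_def Let_def)

lemma push_v: "push K \<phi> j U (gen_v j) = U \<otimes>\<^bsub>K\<^esub> \<phi> (gen_v j)"
  by (simp add: push_def Let_def)

lemma push_s1:
  "push K \<phi> j U (gen_s 1) = \<phi> gen_h [^]\<^bsub>K\<^esub> e \<otimes>\<^bsub>K\<^esub> inv\<^bsub>K\<^esub> word_eval K (push K \<phi> j U) tail_word"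
proof -
  have "word_eval K (push K \<phi> j U) tail_word =
      word_eval K (\<phi>(gen_v j := U \<otimes>\<^bsub>K\<^esub> \<phi> (gen_v j))) tail_word"
    using tail_word_letters by (intro word_eval_cong) (auto simp: words_iff_letters push_def Let_def)
  then show ?thesis by (simp add: push_def Let_def)
qed

lemma push_closed:
  assumes "group K" "\<phi> \<in> gens \<rightarrow> carrier K" "U \<in> carrier K" "j \<in> vs"
  shows "push K \<phi> j U \<in> gens \<rightarrow> carrier K"
proof -
  interpret group K by fact
  have v: "\<phi> (gen_v j) \<in> carrier K" "\<phi> gen_h \<in> carrier K" using assms by auto
  let ?\<phi>1 = "\<phi>(gen_v j := U \<otimes>\<^bsub>K\<^esub> \<phi> (gen_v j))"
  have "?\<phi>1 \<in> gens \<rightarrow> carrier K" using assms v by auto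
  from word_eval_closed[OF is_group this tail_word_gens] show ?thesis
    using assms v by (auto simp: push_def Let_def)
qed

text \<open>
Used to recognize the image of a pushed solution under a homomorphism, and the result of undoing a push,
as pushed solutions.
\<close>
lemma push_unique:
  assumes "\<psi> (gen_v j) = U \<otimes>\<^bsub>K\<^esub> \<phi> (gen_v j)"
    and "\<And>z. z \<in> gens \<Longrightarrow> z \<noteq> gen_s 1 \<Longrightarrow> z \<noteq> gen_v j \<Longrightarrow> \<psi> z = \<phi> z"
    and "\<psi> (gen_s 1) = \<psi> gen_h [^]\<^bsub>K\<^esub> e \<otimes>\<^bsub>K\<^esub> inv\<^bsub>K\<^esub> word_eval K \<psi> tail_word"
    and "z \<in> gens"
  shows "\<psi> z = push K \<phi> j U z"
proof -
  have *: "\<psi> z = push K \<phi> j U z" if "z \<in> gens" "z \<noteq> gen_s 1" for z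
    using that assms(1,2) push_other push_v by metis
  have "word_eval K \<psi> tail_word = word_eval K (push K \<phi> j U) tail_word"
    using tail_word_letters * by (intro word_eval_cong) (auto simp: words_iff_letters)
  moreover have "\<psi> gen_h = \<phi> gen_h" using assms(2)[of gen_h] by simp
  ultimately show ?thesis
    using * assms(3,4) push_s1[of K \<phi> j U] by metis
qed

lemma push_push:
  assumes "group K" "solves K b \<phi>" "j \<in> vs" "U \<in> carrier K" "U' \<in> carrier K"
    and "U' \<otimes>\<^bsub>K\<^esub> U = \<one>\<^bsub>K\<^esub>" "z \<in> gens"
  shows "push K (push K \<phi> j U) j U' z = \<phi> z"
proof -
  interpret group K by fact
  have \<phi>: "\<phi> \<in> gens \<rightarrow> carrier K" using assms(2) by (simp add: solves_def)
  then have v: "\<phi> (gen_v j) \<in> carrier K" using assms(3) by auto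
  show ?thesis
  proof (rule push_unique[symmetric])
    show "\<phi> (gen_v j) = U' \<otimes>\<^bsub>K\<^esub> push K \<phi> j U (gen_v j)"
      using assms v by (simp add: push_v m_assoc[symmetric])
  qed (use assms(2,7) in \<open>auto simp: push_other solves_iff[OF is_group \<phi>]\<close>)
qed

lemma push_hom:
  assumes "group K" "group L" "F \<in> hom K L" "\<phi> \<in> gens \<rightarrow> carrier K" "U \<in> carrier K" "j \<in> vs"
    and "\<And>z. z \<in> gens \<Longrightarrow> \<psi> z = F (\<phi> z)" "z \<in> gens"
  shows "F (push K \<phi> j U z) = push L \<psi> j (F U) z"
proof -
  interpret group_hom K L F using assms by (simp add: group_hom_def group_hom_axioms_def)
  have v: "\<phi> (gen_v j) \<in> carrier K" "\<phi> gen_h \<in> carrier K" using assms by auto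
  note p = push_closed[OF assms(1,4,5,6)]
  show ?thesis
  proof (rule push_unique[where \<psi> = "\<lambda>z. F (push K \<phi> j U z)"])
    show "F (push K \<phi> j U (gen_s 1)) = F (push K \<phi> j U gen_h) [^]\<^bsub>L\<^esub> e \<otimes>\<^bsub>L\<^esub>
        inv\<^bsub>L\<^esub> word_eval L (\<lambda>z. F (push K \<phi> j U z)) tail_word"
      using v word_eval_closed[OF assms(1) p tail_word_gens]
      by (subst push_s1)
         (simp add: push_other hom_int_pow hom_word_eval[OF assms(1,2,3) p tail_word_gens])
  qed (use assms v in \<open>auto simp: push_other push_v\<close>)
qed

text \<open>
The long relator holds by construction and \<open>U\<close> commutes with \<open>h\<close>, so only the two relations of \<open>s\<^sub>1\<close>
need an assumption.
\<close>
lemma push_solves: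
  assumes "group K" "solves K b \<phi>" "j \<in> vs" "conj_acts K (\<phi> gen_h) U 1"
    and "conj_acts K (\<phi> gen_h) (push K \<phi> j U (gen_s 1)) 1"
    and "push K \<phi> j U (gen_s 1) [^]\<^bsub>K\<^esub> a 1 \<otimes>\<^bsub>K\<^esub> \<phi> gen_h [^]\<^bsub>K\<^esub> c = \<one>\<^bsub>K\<^esub>"
  shows "solves K (b(1 := c)) (push K \<phi> j U)"
proof -
  interpret group K by fact
  have \<phi>: "\<phi> \<in> gens \<rightarrow> carrier K" using assms(2) by (simp add: solves_def)
  have h: "\<phi> gen_h \<in> carrier K" using \<phi> by auto
  have p: "push K \<phi> j U \<in> gens \<rightarrow> carrier K"
    using push_closed[OF is_group \<phi> _ assms(3)] assms(4) by (simp add: conj_acts_carrier)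
  note s = assms(2)[unfolded solves_iff[OF is_group \<phi>]]
  have ph: "push K \<phi> j U gen_h = \<phi> gen_h" by (simp add: push_other)
  show ?thesis
    unfolding solves_iff[OF is_group p] ph
  proof (intro conjI ballI)
    fix k assume k: "k \<in> {1..n}"
    show "conj_acts K (\<phi> gen_h) (push K \<phi> j U (gen_s k)) 1"
      using s k assms(5) push_other[of "gen_s k" j K \<phi> U] by (cases "k = 1") auto
    show "push K \<phi> j U (gen_s k) [^]\<^bsub>K\<^esub> a k \<otimes>\<^bsub>K\<^esub> \<phi> gen_h [^]\<^bsub>K\<^esub> (b(1 := c)) k = \<one>\<^bsub>K\<^esub>"
      using s k assms(6) push_other[of "gen_s k" j K \<phi> U] by (cases "k = 1") auto
  next
    fix i assume i: "i \<in> vs"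
    show "conj_acts K (\<phi> gen_h) (push K \<phi> j U (gen_v i)) (fibre_sign eps i)"
    proof (cases "i = j")
      case True
      then show ?thesis
        using conj_acts_mult[OF h assms(4), of "\<phi> (gen_v i)" "fibre_sign eps i"] s i by (simp add: push_v)
    qed (use s i in \<open>simp add: push_other\<close>)
  qed (rule push_s1)
qed

text \<open>
The loop \<open>s\<^sub>1\<close>, transported along the long relator to the place just before the block
of \<open>v\<^sub>j\<close>.
\<close>
definition meridian :: "('k, 'm) monoid_scheme \<Rightarrow> (seifert_gen \<Rightarrow> 'k) \<Rightarrow> nat \<Rightarrow> 'k" where
  "meridian K \<phi> j =
     (let A = word_eval K \<phi> (cones_word @ before_word j)
      in inv\<^bsub>K\<^esub> A \<otimes>\<^bsub>K\<^esub> \<phi> (gen_s 1) \<otimes>\<^bsub>K\<^esub> A)"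

lemma approach_word_letters:
  assumes "j \<in> vs"
  shows "cones_word @ before_word j \<in> words (gens - {gen_s 1, gen_v j})"
proof -
  have "gen_s ` {2..n} \<subseteq> gens - {gen_s 1, gen_v j}" "gen_v ` (vs - {j}) \<subseteq> gens - {gen_s 1, gen_v j}"
    by auto
  then show ?thesis
    using words_mono[OF cones_word_letters] words_mono[OF before_word_letters[OF assms]] by simp
qed

lemma push_meridian:
  assumes "group K" "solves K b \<phi>" "j \<in> vs" "U \<in> carrier K"
  defines "x \<equiv> \<phi> (gen_v j)" and "y \<equiv> \<phi> (mate j)"
    and "A \<equiv> word_eval K \<phi> (cones_word @ before_word j)"
    and "\<kappa> \<equiv> passage_of j"
  shows "push K \<phi> j U (gen_s 1) =
      A \<otimes>\<^bsub>K\<^esub> meridian K (push K \<phi> j U) j \<otimes>\<^bsub>K\<^esub> inv\<^bsub>K\<^esub> A"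
    and "meridian K (push K \<phi> j U) j =
      meridian K \<phi> j \<otimes>\<^bsub>K\<^esub> block\<^bsub>K\<^esub> \<kappa> x y \<otimes>\<^bsub>K\<^esub> inv\<^bsub>K\<^esub> (block\<^bsub>K\<^esub> \<kappa> (U \<otimes>\<^bsub>K\<^esub> x) y)"
proof -
  interpret group K by fact
  let ?P = "push K \<phi> j U"
  have \<phi>: "\<phi> \<in> gens \<rightarrow> carrier K" using assms(2) by (simp add: solves_def)
  note p = push_closed[OF is_group \<phi> assms(4,3)]
  have c: "x \<in> carrier K" "y \<in> carrier K" "\<phi> (gen_s 1) \<in> carrier K" "\<phi> gen_h \<in> carrier K" "?P (gen_s 1) \<in> carrier K"
    using \<phi> p assms(3) mate_gens[OF assms(3)] cone_point by (auto simp: x_def y_def)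
  have aw: "cones_word @ before_word j \<in> words gens"
    using words_mono[OF approach_word_letters[OF assms(3)]] by blast
  have gv: "gen_v ` (vs - {j}) \<subseteq> gens" by auto
  have afw: "after_word j \<in> words gens"
    using words_mono[OF after_word_letters[OF assms(3)] gv] .
  have bw: "block_word j \<in> words gens"
    using tail_word_gens surface_word_split[OF assms(3)] by (simp add: tail_word_def)
  define C where "C = word_eval K \<phi> (after_word j)"
  have A: "A \<in> carrier K" "C \<in> carrier K"
    unfolding A_def C_def using word_eval_closed[OF is_group \<phi>] aw afw by blast+
  have A': "word_eval K ?P (cones_word @ before_word j) = A"
    unfolding A_def using approach_word_letters[OF assms(3)]
    by (intro word_eval_cong push_other) (auto simp: words_iff_letters)
  have C': "word_eval K ?P (after_word j) = C"
    unfolding C_def using after_word_letters[OF assms(3)]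
    by (intro word_eval_cong push_other) (auto simp: words_iff_letters)
  define D where "D = block\<^bsub>K\<^esub> \<kappa> x y"
  define D' where "D' = block\<^bsub>K\<^esub> \<kappa> (U \<otimes>\<^bsub>K\<^esub> x) y"
  have D: "D \<in> carrier K" "D' \<in> carrier K" using c assms(4) by (simp_all add: D_def D'_def)
  have split: "tail_word = (cones_word @ before_word j) @ block_word j @ after_word j"
    using surface_word_split[OF assms(3)] by (simp add: tail_word_def)
  have m: "?P (mate j) = y" using mate_gens[OF assms(3)] by (simp add: y_def push_other)
  have T: "word_eval K \<phi> tail_word = A \<otimes>\<^bsub>K\<^esub> (D \<otimes>\<^bsub>K\<^esub> C)"
    using aw bw afw unfolding split
    by (simp add: word_eval_append[OF is_group \<phi>, of "cones_word @ before_word j"]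
        word_eval_append[OF is_group \<phi>, of "block_word j"] A_def C_def D_def
        word_eval_block_word[OF is_group \<phi> assms(3)] x_def y_def \<kappa>_def del: append_assoc)
  have T': "word_eval K ?P tail_word = A \<otimes>\<^bsub>K\<^esub> (D' \<otimes>\<^bsub>K\<^esub> C)"
    using aw bw afw unfolding split
    by (simp add: word_eval_append[OF is_group p, of "cones_word @ before_word j"]
        word_eval_append[OF is_group p, of "block_word j"] A' C' D'_def m push_v
        word_eval_block_word[OF is_group p assms(3)] x_def \<kappa>_def del: append_assoc)
  have s: "\<phi> (gen_s 1) = \<phi> gen_h [^]\<^bsub>K\<^esub> e \<otimes>\<^bsub>K\<^esub> inv\<^bsub>K\<^esub> word_eval K \<phi> tail_word"
    using assms(2) solves_iff[OF is_group \<phi>] by blast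
  have mer: "meridian K ?P j = inv\<^bsub>K\<^esub> A \<otimes>\<^bsub>K\<^esub> ?P (gen_s 1) \<otimes>\<^bsub>K\<^esub> A"
    unfolding meridian_def Let_def A' ..
  then show "?P (gen_s 1) = A \<otimes>\<^bsub>K\<^esub> meridian K ?P j \<otimes>\<^bsub>K\<^esub> inv\<^bsub>K\<^esub> A"
    using A c by (simp add: m_assoc)
  have "meridian K ?P j = meridian K \<phi> j \<otimes>\<^bsub>K\<^esub> D \<otimes>\<^bsub>K\<^esub> inv\<^bsub>K\<^esub> D'"
    unfolding mer meridian_def[of K \<phi>] Let_def A_def[symmetric] push_s1 T' s T
    using A D c by (simp add: m_assoc inv_mult_group)
  then show "meridian K ?P j = meridian K \<phi> j \<otimes>\<^bsub>K\<^esub> block\<^bsub>K\<^esub> \<kappa> x y \<otimes>\<^bsub>K\<^esub>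
      inv\<^bsub>K\<^esub> (block\<^bsub>K\<^esub> \<kappa> (U \<otimes>\<^bsub>K\<^esub> x) y)"
    by (simp add: D_def D'_def)
qed

end

section \<open>Pushing the first cone point in a Seifert group\<close>

context parity
begin

lemma parity_conjugate:
  "x \<in> carrier G \<Longrightarrow> z \<in> carrier G \<Longrightarrow> f (z \<otimes> x \<otimes> inv z) = f x"
  "x \<in> carrier G \<Longrightarrow> z \<in> carrier G \<Longrightarrow> f (inv z \<otimes> x \<otimes> z) = f x"
  using parity_cases[of x] parity_cases[of z] by (auto simp: parity_mult)

lemma parity_shift:
  assumes "t \<in> carrier G" "x \<in> carrier G" "y \<in> carrier G"
  shows "f (shift \<kappa> d t x y) = f t"
  using assms
  by (cases \<kappa>; cases d) (simp_all only: shift.simps parity_conjugate(2) parity_inv block_closed inv_closed m_closed)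

end

context seifert
begin

definition push_factor :: "('k, 'm) monoid_scheme \<Rightarrow> (seifert_gen \<Rightarrow> 'k) \<Rightarrow> nat \<Rightarrow> bool \<Rightarrow> 'k" where
  "push_factor K \<phi> j d =
     shift\<^bsub>K\<^esub> (passage_of j) d (meridian K \<phi> j) (\<phi> (gen_v j)) (\<phi> (mate j))"

lemma solves_image:
  assumes "group K" "group L" "F \<in> hom K L" "solves K b \<phi>"
  shows "solves L b (\<lambda>z. F (\<phi> z))"
  unfolding solves_def
proof (intro conjI ballI)
  have \<phi>: "\<phi> \<in> gens \<rightarrow> carrier K" using assms(4) by (simp add: solves_def)
  then show "(\<lambda>z. F (\<phi> z)) \<in> gens \<rightarrow> carrier L" using assms(3) by (auto simp: hom_def)
  fix r assume r: "r \<in> rels b"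
  then have "r \<in> words gens" by (rule subsetD[OF seifert_relators_words])
  from hom_word_eval[OF assms(1,2,3) \<phi> this] show "word_eval L (\<lambda>z. F (\<phi> z)) r = \<one>\<^bsub>L\<^esub>"
    using r assms(4) hom_one[OF assms(3,1,2)] by (simp add: solves_def)
qed

lemma meridian_closed:
  assumes "group K" "\<phi> \<in> gens \<rightarrow> carrier K" "j \<in> vs"
  shows "word_eval K \<phi> (cones_word @ before_word j) \<in> carrier K"
    and "meridian K \<phi> j \<in> carrier K"
proof -
  interpret group K by fact
  have "cones_word @ before_word j \<in> words gens"
    using words_mono[OF approach_word_letters[OF assms(3)]] by blast
  from word_eval_closed[OF is_group assms(2) this]
  show "word_eval K \<phi> (cones_word @ before_word j) \<in> carrier K" .
  moreover have "\<phi> (gen_s 1) \<in> carrier K" using assms(2) cone_point by auto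
  ultimately show "meridian K \<phi> j \<in> carrier K" by (simp add: meridian_def Let_def)
qed

lemma meridian_hom:
  assumes "group K" "group L" "F \<in> hom K L" "\<phi> \<in> gens \<rightarrow> carrier K" "j \<in> vs"
    and "\<And>z. z \<in> gens \<Longrightarrow> \<psi> z = F (\<phi> z)"
  shows "F (meridian K \<phi> j) = meridian L \<psi> j"
proof -
  interpret group_hom K L F using assms by (simp add: group_hom_def group_hom_axioms_def)
  have w: "cones_word @ before_word j \<in> words gens"
    using words_mono[OF approach_word_letters[OF assms(5)]] by blast
  have "word_eval L \<psi> (cones_word @ before_word j) = F (word_eval K \<phi> (cones_word @ before_word j))"
    unfolding hom_word_eval[OF assms(1-4) w]
    using w assms(6) by (intro word_eval_cong) (auto simp: words_iff_letters)
  moreover have "\<phi> (gen_s 1) \<in> carrier K" using assms(4) cone_point by auto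
  moreover have "\<psi> (gen_s 1) = F (\<phi> (gen_s 1))" using assms(6) cone_point by simp
  ultimately show ?thesis
    using meridian_closed(1)[OF assms(1,4,5)] by (simp add: meridian_def Let_def)
qed

lemma push_factor_closed:
  assumes "group K" "\<phi> \<in> gens \<rightarrow> carrier K" "j \<in> vs"
  shows "push_factor K \<phi> j d \<in> carrier K"
proof -
  interpret group K by fact
  have "\<phi> (gen_v j) \<in> carrier K" "\<phi> (mate j) \<in> carrier K"
    using assms(2,3) mate_gens[OF assms(3)] by auto
  then show ?thesis
    using meridian_closed(2)[OF is_group assms(2,3)] by (simp add: push_factor_def)
qed

lemma push_factor_hom:
  assumes "group K" "group L" "F \<in> hom K L" "\<phi> \<in> gens \<rightarrow> carrier K" "j \<in> vs"
    and "\<And>z. z \<in> gens \<Longrightarrow> \<psi> z = F (\<phi> z)"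
  shows "F (push_factor K \<phi> j d) = push_factor L \<psi> j d"
proof -
  have "\<phi> (gen_v j) \<in> carrier K" "\<phi> (mate j) \<in> carrier K"
    using assms(4,5) mate_gens[OF assms(5)] by auto
  moreover have "\<psi> (gen_v j) = F (\<phi> (gen_v j))" "\<psi> (mate j) = F (\<phi> (mate j))"
    using assms(5,6) mate_gens[OF assms(5)] by auto
  ultimately show ?thesis
    unfolding push_factor_def
    using hom_shift[OF assms(1-3) meridian_closed(2)[OF assms(1,4,5)]] meridian_hom[OF assms] by simp
qed

lemma push_factor_meridian:
  fixes d :: bool
  assumes "group K" "solves K b \<phi>" "j \<in> vs"
  defines "Z \<equiv> carry\<^bsub>K\<^esub> (passage_of j) d (meridian K \<phi> j) (\<phi> (gen_v j)) (\<phi> (mate j))"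
  shows "meridian K (push K \<phi> j (push_factor K \<phi> j d)) j =
    Z \<otimes>\<^bsub>K\<^esub> meridian K \<phi> j [^]\<^bsub>K\<^esub> flip (passage_of j) \<otimes>\<^bsub>K\<^esub> inv\<^bsub>K\<^esub> Z"
proof -
  interpret group K by fact
  have \<phi>: "\<phi> \<in> gens \<rightarrow> carrier K" using assms(2) by (simp add: solves_def)
  then have "\<phi> (gen_v j) \<in> carrier K" "\<phi> (mate j) \<in> carrier K"
    using assms(3) mate_gens[OF assms(3)] by auto
  then show ?thesis
    using push_meridian(2)[OF is_group assms(2,3) push_factor_closed[OF is_group \<phi> assms(3)], of d]
      shift_block[OF meridian_closed(2)[OF is_group \<phi> assms(3)]]
    unfolding Z_def by (simp add: push_factor_def)
qed

lemma push_factor_inverse: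
  assumes "group K" "solves K b \<phi>" "j \<in> vs"
  shows "push_factor K (push K \<phi> j (push_factor K \<phi> j d)) j (\<not> d) \<otimes>\<^bsub>K\<^esub> push_factor K \<phi> j d = \<one>\<^bsub>K\<^esub>"
proof -
  interpret group K by fact
  have \<phi>: "\<phi> \<in> gens \<rightarrow> carrier K" using assms(2) by (simp add: solves_def)
  then have c: "\<phi> (gen_v j) \<in> carrier K" "\<phi> (mate j) \<in> carrier K"
    using assms(3) mate_gens[OF assms(3)] by auto
  let ?P = "push K \<phi> j (push_factor K \<phi> j d)"
  have "?P (mate j) = \<phi> (mate j)"
    using mate_gens[OF assms(3)] by (simp add: push_other)
  moreover have "?P (gen_v j) = push_factor K \<phi> j d \<otimes>\<^bsub>K\<^esub> \<phi> (gen_v j)"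
    by (rule push_v)
  ultimately show ?thesis
    using shift_inverse[OF meridian_closed(2)[OF is_group \<phi> assms(3)] c _ push_factor_meridian[OF assms, of d]]
    by (simp add: push_factor_def)
qed

lemma cone_sign_product:
  assumes "group K" "solves K b \<phi>" "j \<in> vs"
  obtains \<xi> \<upsilon> where "conj_acts K (\<phi> gen_h) (\<phi> (gen_v j)) \<xi>" "conj_acts K (\<phi> gen_h) (\<phi> (mate j)) \<upsilon>"
    "(if passage_of j = Crosscap then \<xi> else \<upsilon>) * flip (passage_of j) = cone_sign j"
proof -
  interpret group K by fact
  have \<phi>: "\<phi> \<in> gens \<rightarrow> carrier K" using assms(2) by (simp add: solves_def)
  then have h: "\<phi> gen_h \<in> carrier K" by auto
  have v: "conj_acts K (\<phi> gen_h) (\<phi> (gen_v i)) (fibre_sign eps i)" if "i \<in> vs" for i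
    using assms(2) that solves_iff[OF is_group \<phi>] by blast
  show thesis
  proof (cases "orientable_base eps")
    case True
    then obtain i where "mate j = gen_v i" "i \<in> vs" using mate_gens[OF assms(3)] by (auto simp: mate_def)
    moreover have "fibre_sign eps i = fibre_sign eps 1"
      using True by (cases eps) (auto simp: orientable_base_def)
    ultimately show thesis
      using that[OF v[OF assms(3)], of "fibre_sign eps 1"] v[of i] True
      by (auto simp: passage_of_def cone_sign_def flip_def)
  next
    case False
    then show thesis
      using that[OF v[OF assms(3)], of 1] conj_acts_self[OF h]
      by (simp add: passage_of_def cone_sign_def flip_def mate_def)
  qed
qed

lemma cone_sign_cases: "cone_sign j = 1 \<or> cone_sign j = - 1"
  using fibre_sign_cases unfolding cone_sign_def by fastforce

text \<open>
The new \<open>s\<^sub>1\<close> is conjugate to the old one or to its inverse by the path that leads to the block,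
through it and back. The approach and the return cancel in the action on \<open>h\<close>, so \<open>b\<^sub>1\<close> changes by the
sign of the passage alone.
\<close>
lemma push_factor_solves:
  assumes "group K" "solves K b \<phi>" "j \<in> vs"
  shows "solves K (b(1 := cone_sign j * b 1)) (push K \<phi> j (push_factor K \<phi> j d))"
proof -
  interpret group K by fact
  have \<phi>: "\<phi> \<in> gens \<rightarrow> carrier K" using assms(2) by (simp add: solves_def)
  note s = assms(2)[unfolded solves_iff[OF is_group \<phi>]]
  have c: "\<phi> gen_h \<in> carrier K" "\<phi> (gen_s 1) \<in> carrier K"
    using \<phi> cone_point by auto
  note acts = conj_acts_mult[OF c(1)] conj_acts_inv[OF c(1)]
  obtain \<xi> \<upsilon> where v: "conj_acts K (\<phi> gen_h) (\<phi> (gen_v j)) \<xi>" "conj_acts K (\<phi> gen_h) (\<phi> (mate j)) \<upsilon>"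
    and sign: "(if passage_of j = Crosscap then \<xi> else \<upsilon>) * flip (passage_of j) = cone_sign j"
    using cone_sign_product[OF assms] .
  define A where "A = word_eval K \<phi> (cones_word @ before_word j)"
  have A: "A \<in> carrier K" unfolding A_def using meridian_closed(1)[OF is_group \<phi> assms(3)] .
  have n1: "1 \<in> {1..n}" using cone_point by simp
  have s1: "conj_acts K (\<phi> gen_h) (\<phi> (gen_s 1)) 1" using s n1 by blast
  have "\<exists>\<zeta>. conj_acts K (\<phi> gen_h) (\<phi> z) \<zeta>" if "z \<in> gens" for z
  proof (cases z)
    case (gen_s k)
    then have "k \<in> {1..n}" using that by simp
    then show ?thesis using s gen_s by blast
  next
    case (gen_v i)
    then have "i \<in> vs" using that by simp
    then show ?thesis using s gen_v by blast
  qed (use conj_acts_self[OF c(1)] in blast)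
  then obtain \<alpha> where \<alpha>: "conj_acts K (\<phi> gen_h) A \<alpha>"
    unfolding A_def
    using conj_acts_word_eval[OF c(1) words_mono[OF approach_word_letters[OF assms(3)]]] by blast
  define M where "M = meridian K \<phi> j"
  have M: "M = inv\<^bsub>K\<^esub> A \<otimes>\<^bsub>K\<^esub> \<phi> (gen_s 1) \<otimes>\<^bsub>K\<^esub> A"
    by (simp add: M_def meridian_def Let_def A_def)
  then have M_acts: "conj_acts K (\<phi> gen_h) M 1" "M \<in> carrier K"
    using conj_acts_conjugate[OF c(1) s1 \<alpha>] A c by auto
  define Z where "Z = carry\<^bsub>K\<^esub> (passage_of j) d M (\<phi> (gen_v j)) (\<phi> (mate j))"
  define \<zeta> where "\<zeta> = (if passage_of j = Crosscap then \<xi> else \<upsilon>)"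
  define \<eta> where "\<eta> = flip (passage_of j)"
  have Z: "conj_acts K (\<phi> gen_h) Z \<zeta>" "Z \<in> carrier K"
    unfolding Z_def \<zeta>_def using conj_acts_carry[OF c(1) M_acts(1) v] by (blast intro: conj_acts_carrier)+
  let ?U = "push_factor K \<phi> j d"
  let ?s = "push K \<phi> j ?U (gen_s 1)"
  have U: "conj_acts K (\<phi> gen_h) ?U 1"
    unfolding push_factor_def M_def[symmetric] using conj_acts_shift[OF c(1) M_acts(1) v] .
  \<comment> \<open>The path to the block, through it and back: the new \<open>s\<^sub>1\<close> is conjugate by it to the old one.\<close>
  define B where "B = A \<otimes>\<^bsub>K\<^esub> Z \<otimes>\<^bsub>K\<^esub> inv\<^bsub>K\<^esub> A"
  have "conj_acts K (\<phi> gen_h) B (\<alpha> * \<zeta> * \<alpha>)"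
    unfolding B_def by (intro acts \<alpha> Z)
  moreover have "\<alpha> * \<zeta> * \<alpha> = \<zeta>" using \<alpha> by (auto simp: conj_acts_def)
  ultimately have B: "conj_acts K (\<phi> gen_h) B \<zeta>" by simp
  have pow: "M [^]\<^bsub>K\<^esub> \<eta> = inv\<^bsub>K\<^esub> A \<otimes>\<^bsub>K\<^esub> \<phi> (gen_s 1) [^]\<^bsub>K\<^esub> \<eta> \<otimes>\<^bsub>K\<^esub> A"
    using conj_int_pow[of "inv\<^bsub>K\<^esub> A" "\<phi> (gen_s 1)" \<eta>] A c by (simp add: M)
  have "?s = A \<otimes>\<^bsub>K\<^esub> (Z \<otimes>\<^bsub>K\<^esub> M [^]\<^bsub>K\<^esub> \<eta> \<otimes>\<^bsub>K\<^esub> inv\<^bsub>K\<^esub> Z) \<otimes>\<^bsub>K\<^esub> inv\<^bsub>K\<^esub> A"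
    using push_meridian(1)[OF is_group assms(2,3) conj_acts_carrier[OF U]]
      push_factor_meridian[OF assms, of d]
    by (simp add: A_def Z_def M_def \<eta>_def)
  also have "\<dots> = B \<otimes>\<^bsub>K\<^esub> \<phi> (gen_s 1) [^]\<^bsub>K\<^esub> \<eta> \<otimes>\<^bsub>K\<^esub> inv\<^bsub>K\<^esub> B"
    unfolding pow B_def using A Z c by (simp add: m_assoc inv_mult_group)
  finally have conj: "?s = B \<otimes>\<^bsub>K\<^esub> \<phi> (gen_s 1) [^]\<^bsub>K\<^esub> \<eta> \<otimes>\<^bsub>K\<^esub> inv\<^bsub>K\<^esub> B" .
  have "\<phi> (gen_s 1) [^]\<^bsub>K\<^esub> a 1 \<otimes>\<^bsub>K\<^esub> \<phi> gen_h [^]\<^bsub>K\<^esub> b 1 = \<one>\<^bsub>K\<^esub>" using s n1 by blast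
  note rel = conjugate_cone_relation[OF c B this, of \<eta>]
  have cone_sign: "\<zeta> * \<eta> = cone_sign j" using sign by (simp add: \<zeta>_def \<eta>_def)
  show ?thesis
  proof (rule push_solves[OF is_group assms(2,3) U])
    show "conj_acts K (\<phi> gen_h) ?s 1"
      unfolding conj by (rule conjugate_commutes[OF c(1) s1 B])
    show "?s [^]\<^bsub>K\<^esub> a 1 \<otimes>\<^bsub>K\<^esub> \<phi> gen_h [^]\<^bsub>K\<^esub> (cone_sign j * b 1) = \<one>\<^bsub>K\<^esub>"
      using rel unfolding conj cone_sign .
  qed
qed

text \<open>
A homomorphism maps a pushed solution to the pushed image, so the composite sends the generators to
the solution obtained by a push followed by its inverse.
\<close>
lemma push_homs_inverse:
  assumes "j \<in> vs"
    and F: "F \<in> hom (grp b') (grp b)"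
      "\<And>z. z \<in> gens \<Longrightarrow> F (gen b' z) = push (grp b) (gen b) j (push_factor (grp b) (gen b) j d) z"
    and F': "F' \<in> hom (grp b) (grp b')"
      "\<And>z. z \<in> gens \<Longrightarrow> F' (gen b z) = push (grp b') (gen b') j (push_factor (grp b') (gen b') j (\<not> d)) z"
    and x: "x \<in> carrier (grp b)"
  shows "F (F' x) = x"
proof (rule hom_unique[OF group_grp, where F = "\<lambda>x. F (F' x)" and F' = "\<lambda>x. x", OF _ _ _ x])
  show "(\<lambda>x. F (F' x)) \<in> hom (grp b) (grp b)" using hom_compose[OF F'(1) F(1)] by (simp add: comp_def)
  show "(\<lambda>x. x) \<in> hom (grp b) (grp b)" by (auto intro!: homI simp: group.is_monoid[OF group_grp] monoid.m_closed)
  fix z assume z: "z \<in> gens"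
  let ?\<phi> = "push (grp b) (gen b) j (push_factor (grp b) (gen b) j d)"
  have g: "gen b' \<in> gens \<rightarrow> carrier (grp b')" using gen_closed by blast
  have p: "?\<phi> \<in> gens \<rightarrow> carrier (grp b)"
    using gen_closed by (intro push_closed group_grp push_factor_closed assms(1)) auto
  have "F (F' (gen b z)) = push (grp b) ?\<phi> j (F (push_factor (grp b') (gen b') j (\<not> d))) z"
    using F(2) push_hom[OF group_grp group_grp F(1) g push_factor_closed[OF group_grp g assms(1)] assms(1) _ z]
    by (simp add: F'(2) z)
  also have "F (push_factor (grp b') (gen b') j (\<not> d)) = push_factor (grp b) ?\<phi> j (\<not> d)"
    using push_factor_hom[OF group_grp group_grp F(1) g assms(1)] F(2) by simp
  also have "push (grp b) ?\<phi> j (push_factor (grp b) ?\<phi> j (\<not> d)) z = gen b z"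
    using gen_closed push_push[OF group_grp solves_gen assms(1) _ _ push_factor_inverse[OF group_grp solves_gen assms(1)] z]
      push_factor_closed[OF group_grp _ assms(1)] p by blast
  finally show "F (F' (gen b z)) = gen b z" .
qed

lemma kernel_iso:
  assumes "group_isomorphisms H G F F'" "group H" "group G"
  shows "H\<lparr>carrier := kernel H Z (\<lambda>x. f (F x))\<rparr> \<cong> G\<lparr>carrier := kernel G Z f\<rparr>"
proof -
  have "group_isomorphisms (H\<lparr>carrier := kernel H Z (\<lambda>x. f (F x))\<rparr>) (G\<lparr>carrier := kernel G Z f\<rparr>) F F'"
    using assms(1) by (auto simp: group_isomorphisms_def hom_def kernel_def Pi_iff)
  then show ?thesis using group_isomorphisms_imp_iso is_isoI by blast
qed

text \<open>
The factor of \<open>v\<^sub>j\<close> is conjugate to \<open>s\<^sub>1\<close> or to its inverse, hence odd, and so is the new \<open>s\<^sub>1\<close>.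
\<close>
lemma change_parity:
  assumes "f \<in> hom (grp b) parity_group" "f (gen b (gen_s 1)) = 1" "j \<in> vs"
  defines "b' \<equiv> b(1 := cone_sign j * b 1)"
  obtains f' where "f' \<in> hom (grp b') parity_group"
    "\<And>z. z \<in> gens \<Longrightarrow> f' (gen b' z) = (if z = gen_v j then 1 - f (gen b z) else f (gen b z))"
    "(grp b')\<lparr>carrier := kernel (grp b') parity_group f'\<rparr> \<cong> (grp b)\<lparr>carrier := kernel (grp b) parity_group f\<rparr>"
proof -
  interpret parity "grp b" f
    using assms(1) group_grp by (simp add: parity_def parity_axioms_def)
  \<comment> \<open>The inverse push starts from the invariants \<open>b'\<close> and returns to \<open>b\<close>.\<close>
  have b: "b'(1 := cone_sign j * b' 1) = b" using cone_sign_cases[of j] by (auto simp: b'_def)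
  let ?U = "push_factor (grp b) (gen b) j True"
  obtain F where F: "F \<in> hom (grp b') (grp b)" "\<And>z. z \<in> gens \<Longrightarrow> F (gen b' z) = push (grp b) (gen b) j ?U z"
    using solves_hom[OF group_grp push_factor_solves[OF group_grp solves_gen[of b] assms(3), of True]]
    unfolding b'_def by blast
  obtain F' where F': "F' \<in> hom (grp b) (grp b')"
    "\<And>z. z \<in> gens \<Longrightarrow> F' (gen b z) = push (grp b') (gen b') j (push_factor (grp b') (gen b') j False) z"
    using solves_hom[OF group_grp push_factor_solves[OF group_grp solves_gen[of b'] assms(3), of False]]
    unfolding b by blast
  have "group_isomorphisms (grp b') (grp b) F F'"
    unfolding group_isomorphisms_def
    using F F' push_homs_inverse[OF assms(3) F, of F'] push_homs_inverse[OF assms(3) F', of F] by simp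
  note iso = kernel_iso[OF this group_grp group_grp, of parity_group f]
  have g: "gen b \<in> gens \<rightarrow> carrier (grp b)" using gen_closed by blast
  have c: "gen b (gen_s 1) \<in> carrier (grp b)" "gen b (gen_v j) \<in> carrier (grp b)" "gen b (mate j) \<in> carrier (grp b)"
    using gen_closed cone_point assms(3) mate_gens[OF assms(3)] by auto
  note A = meridian_closed[OF group_grp g assms(3)]
  have m: "f (meridian (grp b) (gen b) j) = 1"
    unfolding meridian_def Let_def parity_conjugate(2)[OF c(1) A(1)] by (rule assms(2))
  have U: "?U \<in> carrier (grp b)" using push_factor_closed[OF group_grp g assms(3)] .
  have fU: "f ?U = 1" using parity_shift[OF A(2) c(2,3)] m by (simp add: push_factor_def)
  have "f (meridian (grp b) (push (grp b) (gen b) j ?U) j) = 1"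
    unfolding push_factor_meridian[OF group_grp solves_gen assms(3)]
      parity_conjugate(1)[OF int_pow_closed[OF A(2)] carry_closed[OF A(2) c(2,3)]]
      parity_int_pow[OF A(2)] m
    by (simp add: flip_def)
  then have s: "f (push (grp b) (gen b) j ?U (gen_s 1)) = 1"
    unfolding push_meridian(1)[OF group_grp solves_gen assms(3) U]
      parity_conjugate(1)[OF meridian_closed(2)[OF group_grp push_closed[OF group_grp g U assms(3)] assms(3)] A(1)] .
  show thesis
  proof (rule that[of "\<lambda>x. f (F x)"])
    show "(\<lambda>x. f (F x)) \<in> hom (grp b') parity_group"
      using Group.hom_compose[OF F(1) assms(1)] by (simp only: comp_def)
    fix z assume z: "z \<in> gens"
    show "f (F (gen b' z)) = (if z = gen_v j then 1 - f (gen b z) else f (gen b z))"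
    proof (cases "z = gen_s 1 \<or> z = gen_v j")
      case True
      then show ?thesis
        using z F(2) s assms(2) parity_cases[OF c(2)] fU U c(2) by (auto simp: push_v parity_mult)
    qed (use F(2) z in \<open>simp add: push_other\<close>)
  qed (rule iso)
qed

end

section \<open>Reversing the sign of the first exceptional fibre\<close>

text \<open>
Since all \<open>v\<^sub>j\<close> are even, the letters of the block of \<open>v\<^sub>1\<close> lie in the kernel of the parity. The last
assumption says that the loop through it reverses the orientation of the total space. The odd loop \<open>\<sigma>\<close> is the
second representative of the cosets of the kernel, and \<open>\<tau> = \<sigma>\<^sup>2\<close> is the loop around the
cone point of the double cover.
\<close>
locale odd_cone = seifert +
  fixes b :: "nat \<Rightarrow> int" and f :: "seifert_gen word set \<Rightarrow> int"
  assumes f_hom: "f \<in> hom (grp b) parity_group"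
    and f_s1: "f (gen b (gen_s 1)) = 1" and f_h: "f (gen b gen_h) = 0"
    and f_v: "\<And>j. j \<in> vs \<Longrightarrow> f (gen b (gen_v j)) = 0"
    and v1: "1 \<in> vs" and cone_sign_1: "cone_sign 1 = - 1"
begin

sublocale parity "grp b" f
  using f_hom group_grp by (simp add: parity_def parity_axioms_def)

sublocale even: group even_part
  by (rule group_even_part)

sublocale W: group "wreath2 even_part"
  by (rule even.group_wreath2)

abbreviation \<sigma> :: "seifert_gen word set" where "\<sigma> \<equiv> meridian (grp b) (gen b) 1"
abbreviation \<tau> :: "seifert_gen word set" where "\<tau> \<equiv> \<sigma> \<otimes>\<^bsub>grp b\<^esub> \<sigma>"
abbreviation x1 :: "seifert_gen word set" where "x1 \<equiv> gen b (gen_v 1)"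
abbreviation y1 :: "seifert_gen word set" where "y1 \<equiv> gen b (mate 1)"
abbreviation hh :: "seifert_gen word set" where "hh \<equiv> gen b gen_h"

definition emb :: "seifert_gen \<Rightarrow> seifert_gen word set \<times> seifert_gen word set \<times> bool" where
  "emb z = induced_embedding (grp b) f \<sigma> (gen b z)"

text \<open>
In the double cover \<open>\<tau>\<close> is pushed through the lift of the block of \<open>v\<^sub>1\<close> in the first sheet. The second
coordinate of the factor in \<open>cover_push\<close> is trivial, because the lift in the second sheet stays fixed.
\<close>
definition cover_factor :: "bool \<Rightarrow> seifert_gen word set" where
  "cover_factor d = shift\<^bsub>even_part\<^esub> (passage_of 1) d \<tau> x1 y1"

text \<open>
The loop \<open>\<tau>\<close> after the push, in the form that \<open>shift_block\<close> gives it.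
\<close>
definition pushed_loop :: "bool \<Rightarrow> seifert_gen word set" where
  "pushed_loop d =
     (let Z = carry\<^bsub>even_part\<^esub> (passage_of 1) d \<tau> x1 y1
      in Z \<otimes>\<^bsub>grp b\<^esub> \<tau> [^]\<^bsub>even_part\<^esub> flip (passage_of 1) \<otimes>\<^bsub>grp b\<^esub> inv\<^bsub>even_part\<^esub> Z)"

definition cover_push :: "bool \<Rightarrow> seifert_gen \<Rightarrow> seifert_gen word set \<times> seifert_gen word set \<times> bool" where
  "cover_push d = push (wreath2 even_part) emb 1 (cover_factor d, \<one>\<^bsub>grp b\<^esub>, False)"

lemma gen_Pi: "gen b \<in> gens \<rightarrow> carrier (grp b)"
  using gen_closed by blast

lemma \<sigma>: "\<sigma> \<in> carrier (grp b)" "f \<sigma> = 1"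
proof -
  note A = meridian_closed[OF group_grp gen_Pi v1]
  show "\<sigma> \<in> carrier (grp b)" by (rule A(2))
  have "gen b (gen_s 1) \<in> carrier (grp b)" using gen_closed cone_point by simp
  from parity_conjugate(2)[OF this A(1)] show "f \<sigma> = 1"
    unfolding meridian_def Let_def using f_s1 by (rule HOL.trans)
qed

lemma even_elems: "\<tau> \<in> carrier even_part" "x1 \<in> carrier even_part" "y1 \<in> carrier even_part" "hh \<in> carrier even_part"
proof -
  have "f y1 = 0" using mate_gens[OF v1] f_v f_h by (auto simp: mate_def split: if_splits)
  moreover have "y1 \<in> carrier (grp b)" using mate_gens[OF v1] gen_closed by blast
  moreover have "x1 \<in> carrier (grp b)" "hh \<in> carrier (grp b)" using v1 gen_closed by simp_all
  ultimately show "\<tau> \<in> carrier even_part" "x1 \<in> carrier even_part" "y1 \<in> carrier even_part" "hh \<in> carrier even_part"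
    unfolding mem_even_part using \<sigma> f_h f_v[OF v1] parity_mult[OF \<sigma>(1) \<sigma>(1)] by simp_all
qed

text \<open>
That \<open>a\<^sub>1\<close> is even follows from the parity of the relation \<open>s\<^sub>1\<^bsup>a\<^esup> h\<^bsup>b\<^esup> = 1\<close>; it makes \<open>a\<^sub>1 / 2\<close> available
as the multiplicity of the exceptional fibre of the double cover.
\<close>
lemma cone_relations:
  shows "\<sigma> \<otimes>\<^bsub>grp b\<^esub> hh = hh \<otimes>\<^bsub>grp b\<^esub> \<sigma>" "\<sigma> [^]\<^bsub>grp b\<^esub> a 1 \<otimes>\<^bsub>grp b\<^esub> hh [^]\<^bsub>grp b\<^esub> b 1 = \<one>\<^bsub>grp b\<^esub>"
    "even (a 1)"
proof -
  note s = solves_gen[of b, unfolded solves_iff[OF group_grp gen_Pi]]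
  have n1: "1 \<in> {1..n}" using cone_point by simp
  have c: "hh \<in> carrier (grp b)" "gen b (gen_s 1) \<in> carrier (grp b)" using gen_closed cone_point by simp_all
  have h: "conj_acts (grp b) hh (gen b (gen_s 1)) 1" using s n1 by blast
  have r: "gen b (gen_s 1) [^]\<^bsub>grp b\<^esub> a 1 \<otimes>\<^bsub>grp b\<^esub> hh [^]\<^bsub>grp b\<^esub> b 1 = \<one>\<^bsub>grp b\<^esub>" using s n1 by blast
  define A where "A = word_eval (grp b) (gen b) (cones_word @ before_word 1)"
  have "conj_acts (grp b) hh A 1"
    unfolding A_def before_word_1
    using s by (intro conj_acts_word_eval_1[OF c(1), of _ "gen_s ` {2..n}"]) (auto simp: cones_word_letters)
  from conj_acts_inv[OF c(1) this] have A: "conj_acts (grp b) hh (inv\<^bsub>grp b\<^esub> A) 1" "A \<in> carrier (grp b)"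
    using meridian_closed(1)[OF group_grp gen_Pi v1] by (simp_all add: A_def)
  have \<sigma>A: "\<sigma> = inv\<^bsub>grp b\<^esub> A \<otimes>\<^bsub>grp b\<^esub> gen b (gen_s 1) [^]\<^bsub>grp b\<^esub> (1::int) \<otimes>\<^bsub>grp b\<^esub> inv\<^bsub>grp b\<^esub> (inv\<^bsub>grp b\<^esub> A)"
    using A c by (simp add: meridian_def A_def Let_def)
  show "\<sigma> \<otimes>\<^bsub>grp b\<^esub> hh = hh \<otimes>\<^bsub>grp b\<^esub> \<sigma>"
    using conjugate_commutes[OF c(1) h A(1), of 1] unfolding \<sigma>A[symmetric] conj_acts_1_iff[OF c(1)] by blast
  show "\<sigma> [^]\<^bsub>grp b\<^esub> a 1 \<otimes>\<^bsub>grp b\<^esub> hh [^]\<^bsub>grp b\<^esub> b 1 = \<one>\<^bsub>grp b\<^esub>"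
    using conjugate_cone_relation[OF c A(1) r, of 1] unfolding \<sigma>A[symmetric] by simp
  have "f (gen b (gen_s 1) [^]\<^bsub>grp b\<^esub> a 1 \<otimes>\<^bsub>grp b\<^esub> hh [^]\<^bsub>grp b\<^esub> b 1) = (a 1) mod 2"
    using parity_mult[OF int_pow_closed[OF c(2)] int_pow_closed[OF c(1)]]
    unfolding parity_int_pow[OF c(1)] parity_int_pow[OF c(2)] f_s1 f_h by simp
  then show "even (a 1)" unfolding r by auto
qed

lemma emb_hom: "induced_embedding (grp b) f \<sigma> \<in> hom (grp b) (wreath2 even_part)"
  by (rule induced_embedding_hom[OF \<sigma>])

lemma emb_solves: "solves (wreath2 even_part) b emb"
  using solves_image[OF group_grp even.group_wreath2 emb_hom solves_gen] by (simp add: emb_def[abs_def])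

lemma emb_Pi: "emb \<in> gens \<rightarrow> carrier (wreath2 even_part)"
  using emb_solves by (simp add: solves_def)

lemma emb_even:
  "gen b z \<in> carrier even_part \<Longrightarrow>
    emb z = (gen b z, \<sigma> \<otimes>\<^bsub>grp b\<^esub> gen b z \<otimes>\<^bsub>grp b\<^esub> inv\<^bsub>grp b\<^esub> \<sigma>, False)"
  by (simp add: emb_def induced_embedding_def mem_kernel)

lemma emb_h: "emb gen_h = (hh, hh, False)"
  using emb_even[OF even_elems(4)] even_elems(4) \<sigma>(1) cone_relations(1)
  by (simp add: mem_kernel m_assoc)

lemma conj_even:
  "u \<in> carrier even_part \<Longrightarrow> \<sigma> \<otimes>\<^bsub>grp b\<^esub> u \<otimes>\<^bsub>grp b\<^esub> inv\<^bsub>grp b\<^esub> \<sigma> \<in> carrier even_part"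
  unfolding mem_even_part using \<sigma>(1) parity_conjugate(1) by simp

lemma emb_meridian: "meridian (wreath2 even_part) emb 1 = (\<one>\<^bsub>grp b\<^esub>, \<tau>, True)"
  using meridian_hom[OF group_grp even.group_wreath2 emb_hom gen_Pi v1, of emb] \<sigma>
  by (simp add: emb_def induced_embedding_def)

lemma block_wreath2:
  assumes "u \<in> carrier even_part" "v \<in> carrier even_part" "u' \<in> carrier even_part" "v' \<in> carrier even_part"
  shows "block\<^bsub>wreath2 even_part\<^esub> \<kappa> (u, u', False) (v, v', False) =
    (block\<^bsub>even_part\<^esub> \<kappa> u v, block\<^bsub>even_part\<^esub> \<kappa> u' v', False)"
  using assms by (cases \<kappa>) simp_all

lemma cover_factor_even: "cover_factor d \<in> carrier even_part"
  unfolding cover_factor_def using even_elems by (intro even.shift_closed)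

lemma factor_closed: "(cover_factor d, \<one>\<^bsub>grp b\<^esub>, False) \<in> carrier (wreath2 even_part)"
  using cover_factor_even even.one_closed by simp

lemma pushed_loop_even: "pushed_loop d \<in> carrier even_part"
  unfolding pushed_loop_def Let_def
  using even_elems even.m_closed even.carry_closed even.inv_closed even.int_pow_closed
  by (metis even_part_simps(1))

text \<open>
In the wreath product \<open>\<sigma>\<close> is \<open>(1, \<tau>, True)\<close>. The blocks in the second sheet cancel, and in the first
coordinate \<open>shift_block\<close> applies to \<open>\<tau>\<close>; the exchange of coordinates moves the result to the second.
\<close>
lemma cover_push_meridian:
  "meridian (wreath2 even_part) (cover_push d) 1 = (\<one>\<^bsub>grp b\<^esub>, pushed_loop d, True)"
proof -
  note c = even_elems conj_even[OF even_elems(2)] conj_even[OF even_elems(3)] cover_factor_even[of d]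
  let ?\<kappa> = "passage_of 1"
  let ?D = "block\<^bsub>even_part\<^esub> ?\<kappa> x1 y1"
  let ?D' = "block\<^bsub>even_part\<^esub> ?\<kappa> (cover_factor d \<otimes>\<^bsub>even_part\<^esub> x1) y1"
  let ?E = "block\<^bsub>even_part\<^esub> ?\<kappa> (\<sigma> \<otimes>\<^bsub>grp b\<^esub> x1 \<otimes>\<^bsub>grp b\<^esub> inv\<^bsub>grp b\<^esub> \<sigma>) (\<sigma> \<otimes>\<^bsub>grp b\<^esub> y1 \<otimes>\<^bsub>grp b\<^esub> inv\<^bsub>grp b\<^esub> \<sigma>)"
  have D: "?D \<in> carrier even_part" "?D' \<in> carrier even_part" "?E \<in> carrier even_part"
    using c by (metis even.block_closed even.m_closed)+
  have 1: "block\<^bsub>wreath2 even_part\<^esub> ?\<kappa> (emb (gen_v 1)) (emb (mate 1)) = (?D, ?E, False)"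
    unfolding emb_even[OF even_elems(2)] emb_even[OF even_elems(3)] by (rule block_wreath2) (use c in auto)
  have "(cover_factor d, \<one>\<^bsub>grp b\<^esub>, False) \<otimes>\<^bsub>wreath2 even_part\<^esub> emb (gen_v 1) =
      (cover_factor d \<otimes>\<^bsub>even_part\<^esub> x1, \<sigma> \<otimes>\<^bsub>grp b\<^esub> x1 \<otimes>\<^bsub>grp b\<^esub> inv\<^bsub>grp b\<^esub> \<sigma>, False)"
    unfolding emb_even[OF even_elems(2)] using c(5) by (simp add: mem_kernel)
  then have 2: "block\<^bsub>wreath2 even_part\<^esub> ?\<kappa>
      ((cover_factor d, \<one>\<^bsub>grp b\<^esub>, False) \<otimes>\<^bsub>wreath2 even_part\<^esub> emb (gen_v 1)) (emb (mate 1)) = (?D', ?E, False)"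
    unfolding emb_even[OF even_elems(3)]
    by (simp only:) (rule block_wreath2, use c even.m_closed in auto)
  have "meridian (wreath2 even_part) (cover_push d) 1 =
      (\<one>\<^bsub>even_part\<^esub>, \<tau> \<otimes>\<^bsub>even_part\<^esub> ?D \<otimes>\<^bsub>even_part\<^esub> inv\<^bsub>even_part\<^esub> ?D', True)"
    unfolding cover_push_def
      push_meridian(2)[OF even.group_wreath2 emb_solves v1 factor_closed] 1 2 emb_meridian
    using D even.inv_wreath2[OF D(2,3), of False] even.r_inv[OF D(3)] by (simp add: mem_kernel del: even_part_simps)
  also have "\<tau> \<otimes>\<^bsub>even_part\<^esub> ?D \<otimes>\<^bsub>even_part\<^esub> inv\<^bsub>even_part\<^esub> ?D' = pushed_loop d"
    using even.shift_block[OF even_elems(1,2,3), of ?\<kappa> d]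
    by (simp add: pushed_loop_def cover_factor_def Let_def)
  finally show ?thesis by simp
qed

lemma conj_acts_even_part:
  assumes "conj_acts (grp b) hh z \<zeta>" "z \<in> carrier even_part"
  shows "conj_acts even_part hh z \<zeta>"
  using assms inv_even_part[OF assms(2)] int_pow_even_part[OF even_elems(4), of \<zeta>]
  by (simp add: conj_acts_def)

lemma pushed_loop_relations:
  assumes "a 1 = 2 * k"
  shows "conj_acts even_part hh (pushed_loop d) 1"
    and "pushed_loop d [^]\<^bsub>even_part\<^esub> k \<otimes>\<^bsub>even_part\<^esub> hh [^]\<^bsub>even_part\<^esub> (- b 1) = \<one>\<^bsub>even_part\<^esub>"
proof -
  obtain \<xi> \<upsilon> where v: "conj_acts (grp b) hh x1 \<xi>" "conj_acts (grp b) hh y1 \<upsilon>"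
    and sign: "(if passage_of 1 = Crosscap then \<xi> else \<upsilon>) * flip (passage_of 1) = cone_sign 1"
    using cone_sign_product[OF group_grp solves_gen v1] .
  define \<kappa> where "\<kappa> = passage_of 1"
  define \<zeta> where "\<zeta> = (if \<kappa> = Crosscap then \<xi> else \<upsilon>)"
  have c: "hh \<in> carrier (grp b)" using gen_closed by simp
  have "conj_acts (grp b) hh \<sigma> 1"
    using cone_relations(1) \<sigma> by (simp only: conj_acts_1_iff[OF c])
  from conj_acts_mult[OF c this this] have "conj_acts (grp b) hh \<tau> 1" by simp
  from conj_acts_even_part[OF this even_elems(1)]
  have t: "conj_acts even_part hh \<tau> 1" .
  define Z where "Z = carry\<^bsub>even_part\<^esub> \<kappa> d \<tau> x1 y1"
  have Z: "conj_acts even_part hh Z \<zeta>"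
    unfolding Z_def \<zeta>_def
    by (intro even.conj_acts_carry even_elems t conj_acts_even_part v)
  have loop: "pushed_loop d = Z \<otimes>\<^bsub>even_part\<^esub> \<tau> [^]\<^bsub>even_part\<^esub> flip \<kappa> \<otimes>\<^bsub>even_part\<^esub> inv\<^bsub>even_part\<^esub> Z"
    by (simp add: pushed_loop_def Z_def \<kappa>_def Let_def)
  show "conj_acts even_part hh (pushed_loop d) 1"
    unfolding loop by (rule even.conjugate_commutes[OF even_elems(4) t Z])
  have "\<tau> = \<sigma> [^]\<^bsub>grp b\<^esub> (2::int)"
    using int_pow_mult[OF \<sigma>(1), of 1 1] \<sigma>(1) by simp
  then have "\<tau> [^]\<^bsub>grp b\<^esub> k = \<sigma> [^]\<^bsub>grp b\<^esub> a 1"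
    using int_pow_pow[OF \<sigma>(1), of 2 k] assms by (simp only:)
  then have "\<tau> [^]\<^bsub>grp b\<^esub> k \<otimes>\<^bsub>grp b\<^esub> hh [^]\<^bsub>grp b\<^esub> b 1 = \<one>\<^bsub>grp b\<^esub>"
    using cone_relations(2) by (simp only:)
  then have "\<tau> [^]\<^bsub>even_part\<^esub> k \<otimes>\<^bsub>even_part\<^esub> hh [^]\<^bsub>even_part\<^esub> b 1 = \<one>\<^bsub>even_part\<^esub>"
    using int_pow_even_part[OF even_elems(1)] int_pow_even_part[OF even_elems(4)]
    by (simp only: even_part_simps)
  note rel = even.conjugate_cone_relation[OF even_elems(4,1) Z this, of "flip \<kappa>"]
  have "\<zeta> * flip \<kappa> * b 1 = - b 1"
    using sign cone_sign_1 by (simp add: \<zeta>_def \<kappa>_def)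
  then show "pushed_loop d [^]\<^bsub>even_part\<^esub> k \<otimes>\<^bsub>even_part\<^esub> hh [^]\<^bsub>even_part\<^esub> (- b 1) = \<one>\<^bsub>even_part\<^esub>"
    using rel unfolding loop by (simp only:)
qed

lemma cover_push_s1:
  "cover_push d (gen_s 1) = word_eval (wreath2 even_part) emb (cones_word @ before_word 1)
    \<otimes>\<^bsub>wreath2 even_part\<^esub> (\<one>\<^bsub>grp b\<^esub>, pushed_loop d, True)
    \<otimes>\<^bsub>wreath2 even_part\<^esub>
      inv\<^bsub>wreath2 even_part\<^esub> word_eval (wreath2 even_part) emb (cones_word @ before_word 1)"
  using push_meridian(1)[OF even.group_wreath2 emb_solves v1 factor_closed, of d]
    cover_push_meridian[of d]
  by (simp only: cover_push_def)

text \<open>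
The square of the new \<open>\<sigma>\<close> is diagonal with entries \<open>pushed_loop\<close>, whose power with exponent \<open>a\<^sub>1 / 2\<close> is
\<open>h\<^bsup>b\<^esup>\<close> with \<open>b = b\<^sub>1\<close>; this is the relation with \<open>- b\<^sub>1\<close>.
\<close>
lemma cover_push_solves: "solves (wreath2 even_part) (b(1 := - b 1)) (cover_push d)"
proof -
  obtain k where k: "a 1 = 2 * k" using cone_relations(3) by blast
  note loop = pushed_loop_relations[OF k, of d]
  let ?t = "(\<one>\<^bsub>grp b\<^esub>, pushed_loop d, True)"
  define A where "A = word_eval (wreath2 even_part) emb (cones_word @ before_word 1)"
  note s = emb_solves[unfolded solves_iff[OF even.group_wreath2 emb_Pi]]
  have h: "emb gen_h \<in> carrier (wreath2 even_part)" using emb_Pi by auto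
  have A: "conj_acts (wreath2 even_part) (emb gen_h) A 1"
    unfolding A_def before_word_1
    using s by (intro W.conj_acts_word_eval_1[OF h, of _ "gen_s ` {2..n}"]) (auto simp: cones_word_letters)
  have t_closed: "?t \<in> carrier (wreath2 even_part)"
    using pushed_loop_even[of d] even.one_closed by simp
  have t: "conj_acts (wreath2 even_part) (emb gen_h) ?t 1"
    using loop(1) t_closed even_elems(4)
    unfolding W.conj_acts_1_iff[OF h] even.conj_acts_1_iff[OF even_elems(4)] unfolding emb_h
    by (simp add: mem_kernel)
  have sq: "?t [^]\<^bsub>wreath2 even_part\<^esub> (2::int) = (pushed_loop d, pushed_loop d, False)"
    using W.int_pow_mult[OF t_closed, of 1 1] t_closed pushed_loop_even[of d]
    by (simp add: mem_kernel)
  have "?t [^]\<^bsub>wreath2 even_part\<^esub> a 1 =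
      (pushed_loop d [^]\<^bsub>even_part\<^esub> k, pushed_loop d [^]\<^bsub>even_part\<^esub> k, False)"
    using W.int_pow_pow[OF t_closed, of 2 k] even.int_pow_diagonal[OF pushed_loop_even, of d k]
    unfolding k sq by simp
  then have "?t [^]\<^bsub>wreath2 even_part\<^esub> a 1 \<otimes>\<^bsub>wreath2 even_part\<^esub>
      emb gen_h [^]\<^bsub>wreath2 even_part\<^esub> (- b 1) = \<one>\<^bsub>wreath2 even_part\<^esub>"
    using even.int_pow_diagonal[OF even_elems(4), of "- b 1"] loop(2) unfolding emb_h by simp
  note rel = W.conjugate_cone_relation[OF h t_closed A this, of 1]
  have U: "conj_acts (wreath2 even_part) (emb gen_h) (cover_factor d, \<one>\<^bsub>grp b\<^esub>, False) 1"
  proof -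
    obtain \<xi> \<upsilon> where v: "conj_acts (grp b) hh x1 \<xi>" "conj_acts (grp b) hh y1 \<upsilon>"
      using cone_sign_product[OF group_grp solves_gen v1] by blast
    have c: "hh \<in> carrier (grp b)" using gen_closed by simp
    have "conj_acts (grp b) hh \<sigma> 1"
      using cone_relations(1) \<sigma> by (simp only: conj_acts_1_iff[OF c])
    from conj_acts_mult[OF c this this] have "conj_acts (grp b) hh \<tau> 1" by simp
    from even.conj_acts_shift[OF even_elems(4) conj_acts_even_part[OF this even_elems(1)]
        conj_acts_even_part[OF v(1) even_elems(2)] conj_acts_even_part[OF v(2) even_elems(3)]]
    have "conj_acts even_part hh (cover_factor d) 1"
      unfolding cover_factor_def .
    then show ?thesis
      using factor_closed[of d] even_elems(4)
      unfolding W.conj_acts_1_iff[OF h] even.conj_acts_1_iff[OF even_elems(4)] unfolding emb_h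
      by (simp add: mem_kernel)
  qed
  have s1: "cover_push d (gen_s 1) = A \<otimes>\<^bsub>wreath2 even_part\<^esub> ?t [^]\<^bsub>wreath2 even_part\<^esub> (1::int)
      \<otimes>\<^bsub>wreath2 even_part\<^esub> inv\<^bsub>wreath2 even_part\<^esub> A"
    using cover_push_s1[of d] unfolding A_def W.int_pow_1[OF t_closed] .
  show ?thesis
    unfolding cover_push_def
  proof (rule push_solves[OF even.group_wreath2 emb_solves v1 U], fold cover_push_def)
    show "conj_acts (wreath2 even_part) (emb gen_h) (cover_push d (gen_s 1)) 1"
      unfolding s1 by (rule W.conjugate_commutes[OF h t A])
    show "cover_push d (gen_s 1) [^]\<^bsub>wreath2 even_part\<^esub> a 1 \<otimes>\<^bsub>wreath2 even_part\<^esub>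
        emb gen_h [^]\<^bsub>wreath2 even_part\<^esub> (- b 1) = \<one>\<^bsub>wreath2 even_part\<^esub>"
      using rel unfolding s1 by (simp only: mult_1)
  qed
qed

lemma cover_hom:
  assumes "f' \<in> hom (grp (b(1 := - b 1))) parity_group"
    and "\<And>z. z \<in> gens \<Longrightarrow> f' (gen (b(1 := - b 1)) z) = f (gen b z)"
  obtains \<Theta> where "\<Theta> \<in> hom (grp (b(1 := - b 1))) (wreath2 even_part)"
    "\<And>z. z \<in> gens \<Longrightarrow> \<Theta> (gen (b(1 := - b 1)) z) = cover_push d z"
    "\<And>x. x \<in> carrier (grp (b(1 := - b 1))) \<Longrightarrow> snd (snd (\<Theta> x)) \<longleftrightarrow> f' x = 1"
proof -
  let ?b = "b(1 := - b 1)"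
  obtain \<Theta> where T: "\<Theta> \<in> hom (grp ?b) (wreath2 even_part)"
    "\<And>z. z \<in> gens \<Longrightarrow> \<Theta> (gen ?b z) = cover_push d z"
    using solves_hom[OF even.group_wreath2 cover_push_solves[of d]] by blast
  \<comment> \<open>The Boolean of the wreath product, read as a morphism to \<open>\<int>/2\<close>.\<close>
  let ?p = "\<lambda>q :: seifert_gen word set \<times> seifert_gen word set \<times> bool. if snd (snd q) then 1 else 0 :: int"
  have p: "?p \<in> hom (wreath2 even_part) parity_group"
    by (rule homI) (auto simp: carrier_integer_mod_group)
  interpret p: group_hom "wreath2 even_part" parity_group ?p
    using p by unfold_locales
  have eq: "?p (\<Theta> x) = f' x" if x: "x \<in> carrier (grp ?b)" for x
  proof (rule hom_unique[OF group_integer_mod_group _ assms(1) _ x, of "\<lambda>x. ?p (\<Theta> x)"])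
    show "(\<lambda>x. ?p (\<Theta> x)) \<in> hom (grp ?b) parity_group"
      using Group.hom_compose[OF T(1) p] by (simp only: comp_def)
    fix z assume z: "z \<in> gens"
    have e: "?p (emb z) = f (gen b z)"
      using parity_cases[OF gen_closed[OF z]] by (auto simp: emb_def induced_embedding_def)
    show "?p (\<Theta> (gen ?b z)) = f' (gen ?b z)"
    proof -
      consider "z = gen_s 1" | "z = gen_v 1" | "z \<noteq> gen_s 1" "z \<noteq> gen_v 1" by blast
      then show ?thesis
      proof cases
        case 1
        let ?A = "word_eval (wreath2 even_part) emb (cones_word @ before_word 1)"
        have "?A \<in> carrier (wreath2 even_part)"
          by (rule meridian_closed(1)[OF even.group_wreath2 emb_Pi v1])
        then obtain u v c where A: "?A = (u, v, c)" "u \<in> carrier even_part" "v \<in> carrier even_part"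
          by (cases ?A) auto
        have "snd (snd (cover_push d (gen_s 1)))"
          unfolding cover_push_s1 A(1) even.inv_wreath2[OF A(2,3)] by simp
        then show ?thesis using 1 T(2)[OF z] assms(2)[OF z] f_s1 by (simp only: if_True)
      next
        case 2
        have "snd (snd (cover_push d (gen_v 1))) = snd (snd (emb (gen_v 1)))"
          by (cases "emb (gen_v 1)") (simp add: cover_push_def push_v)
        then show ?thesis using 2 e T(2)[OF z] assms(2)[OF z] by (simp only:)
      next
        case 3
        then have "cover_push d z = emb z" by (simp add: cover_push_def push_other)
        then show ?thesis using e T(2)[OF z] assms(2)[OF z] by (simp only:)
      qed
    qed
  qed
  have "snd (snd (\<Theta> x)) \<longleftrightarrow> f' x = 1" if "x \<in> carrier (grp ?b)" for x
    using eq[OF that] by (auto split: if_splits)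
  then show thesis using that T by blast
qed

end

text \<open>
Write \<open>\<psi>\<close> for the first coordinate of \<open>\<Theta>\<close> on the kernel. Applying \<open>\<psi>\<close> to both coordinates of \<open>\<Theta>'\<close>
gives a homomorphism that sends the generators to a pushed solution pushed back, hence is the induced
embedding, whose first coordinate on the kernel is the identity.
\<close>
lemma (in seifert) flip_cone_sign_inverse:
  assumes P: "odd_cone e eps g n a b f" and Q: "odd_cone e eps g n a b' f'"
    and b': "b' = b(1 := - b 1)"
    and T: "\<Theta> \<in> hom (grp b') (wreath2 ((grp b)\<lparr>carrier := kernel (grp b) parity_group f\<rparr>))"
      "\<And>z. z \<in> gens \<Longrightarrow> \<Theta> (gen b' z) = odd_cone.cover_push e eps g n a b f d z"
      "\<And>x. x \<in> carrier (grp b') \<Longrightarrow> snd (snd (\<Theta> x)) \<longleftrightarrow> f' x = 1"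
    and T': "\<Theta>' \<in> hom (grp b) (wreath2 ((grp b')\<lparr>carrier := kernel (grp b') parity_group f'\<rparr>))"
      "\<And>z. z \<in> gens \<Longrightarrow> \<Theta>' (gen b z) = odd_cone.cover_push e eps g n a b' f' (\<not> d) z"
      "\<And>x. x \<in> carrier (grp b) \<Longrightarrow> snd (snd (\<Theta>' x)) \<longleftrightarrow> f x = 1"
    and x: "x \<in> kernel (grp b) parity_group f"
  shows "fst (\<Theta> (fst (\<Theta>' x))) = x"
proof -
  interpret P: odd_cone e eps g n a b f by (rule P)
  interpret Q: odd_cone e eps g n a b' f' by (rule Q)
  define \<psi> where "\<psi> = (\<lambda>x. fst (\<Theta> x))"
  let ?K = P.even_part and ?K' = Q.even_part
  let ?W = "wreath2 ?K" and ?W' = "wreath2 ?K'"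
  \<comment> \<open>The first coordinate is trivial: the normalization under which \<open>\<psi>\<close> determines \<open>\<Theta>\<close>.\<close>
  have mer: "\<Theta> Q.\<sigma> = (\<one>\<^bsub>grp b\<^esub>, P.pushed_loop d, True)"
    using meridian_hom[OF group_grp P.even.group_wreath2 T(1) Q.gen_Pi P.v1, of "P.cover_push d"] T(2)
      P.cover_push_meridian[of d] by simp
  have \<psi>: "\<psi> \<in> hom ?K' ?K"
    unfolding \<psi>_def by (rule Q.wreath_hom_restrict[OF P.group_even_part T(1,3)])
  have ind: "map_wreath \<psi> (induced_embedding (grp b') f' Q.\<sigma> x) = \<Theta> x" if "x \<in> carrier (grp b')" for x
    unfolding \<psi>_def
    using Q.wreath_hom_induced[OF P.group_even_part T(1,3) Q.\<sigma> _ that] mer by simp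
  have emb: "map_wreath \<psi> (Q.emb z) = P.cover_push d z" if "z \<in> gens" for z
    unfolding Q.emb_def ind[OF gen_closed[OF that]] T(2)[OF that] ..
  note even = P.even_elems and even' = Q.even_elems
  have "\<Theta> Q.\<tau> = \<Theta> Q.\<sigma> \<otimes>\<^bsub>?W\<^esub> \<Theta> Q.\<sigma>"
    using hom_mult[OF T(1) Q.\<sigma>(1) Q.\<sigma>(1)] .
  then have t: "\<psi> Q.\<tau> = P.pushed_loop d"
    unfolding \<psi>_def mer using P.pushed_loop_even[of d] by (simp add: P.mem_kernel)
  have "\<psi> Q.x1 = fst (P.cover_push d (gen_v 1))"
    using T(2)[of "gen_v 1"] P.v1 by (simp add: \<psi>_def)
  then have v: "\<psi> Q.x1 = P.cover_factor d \<otimes>\<^bsub>?K\<^esub> P.x1"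
    by (simp add: P.cover_push_def push_v P.emb_even[OF even(2)] del: P.even_part_simps One_nat_def)
  have "\<psi> Q.y1 = fst (P.cover_push d (mate 1))"
    using T(2)[of "mate 1"] mate_gens[OF P.v1] by (simp add: \<psi>_def)
  then have y: "\<psi> Q.y1 = P.y1"
    using mate_gens[OF P.v1] P.emb_even[OF even(3)] by (simp add: P.cover_push_def push_other)
  have "\<psi> (Q.cover_factor (\<not> d)) = shift\<^bsub>?K\<^esub> (passage_of 1) (\<not> d) (P.pushed_loop d) (P.cover_factor d \<otimes>\<^bsub>?K\<^esub> P.x1) P.y1"
    unfolding Q.cover_factor_def
      hom_shift[OF Q.group_even_part P.group_even_part \<psi> even'(1,2,3)] t v y ..
  then have inv: "\<psi> (Q.cover_factor (\<not> d)) \<otimes>\<^bsub>?K\<^esub> P.cover_factor d = \<one>\<^bsub>?K\<^esub>"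
    using P.even.shift_inverse[OF even(1,2,3), of "P.cover_factor d \<otimes>\<^bsub>?K\<^esub> P.x1" "passage_of 1" d "P.pushed_loop d"]
    by (simp add: P.cover_factor_def P.pushed_loop_def Let_def)
  have one: "\<psi> \<one>\<^bsub>grp b'\<^esub> = \<one>\<^bsub>grp b\<^esub>"
    using hom_one[OF \<psi> Q.group_even_part P.group_even_part] by simp
  have \<psi>U: "\<psi> (Q.cover_factor (\<not> d)) \<in> carrier ?K"
    using \<psi> Q.cover_factor_even by (auto simp: hom_def)
  note map = map_wreath_hom[OF \<psi>]
  have "map_wreath \<psi> (\<Theta>' x) = induced_embedding (grp b) f P.\<sigma> x"
  proof (rule hom_unique[OF P.even.group_wreath2 _ P.emb_hom, of "\<lambda>x. map_wreath \<psi> (\<Theta>' x)"])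
    show "(\<lambda>x. map_wreath \<psi> (\<Theta>' x)) \<in> hom (grp b) ?W"
      using hom_compose[OF T'(1) map] by (simp only: comp_def)
    show "x \<in> carrier (grp b)" using x by (simp add: P.mem_kernel)
    fix z assume z: "z \<in> gens"
    have "map_wreath \<psi> (\<Theta>' (gen b z)) =
        push ?W (P.cover_push d) 1 (map_wreath \<psi> (Q.cover_factor (\<not> d), \<one>\<^bsub>grp b'\<^esub>, False)) z"
      unfolding T'(2)[OF z] Q.cover_push_def
      using emb
      by (intro push_hom[OF Q.even.group_wreath2 P.even.group_wreath2 map Q.emb_Pi Q.factor_closed P.v1 _ z]) simp
    also have "\<dots> = P.emb z"
      unfolding P.cover_push_def
    proof (rule push_push[OF P.even.group_wreath2 P.emb_solves P.v1 P.factor_closed _ _ z])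
      show "map_wreath \<psi> (Q.cover_factor (\<not> d), \<one>\<^bsub>grp b'\<^esub>, False) \<in> carrier ?W"
        using \<psi>U P.even.one_closed by (simp add: one)
      show "map_wreath \<psi> (Q.cover_factor (\<not> d), \<one>\<^bsub>grp b'\<^esub>, False) \<otimes>\<^bsub>?W\<^esub>
          (P.cover_factor d, \<one>\<^bsub>grp b\<^esub>, False) = \<one>\<^bsub>?W\<^esub>"
        using inv by (simp add: one)
    qed
    finally show "map_wreath \<psi> (\<Theta>' (gen b z)) = induced_embedding (grp b) f P.\<sigma> (gen b z)"
      by (simp add: P.emb_def)
  qed
  then show ?thesis
    using x by (cases "\<Theta>' x") (simp add: induced_embedding_def P.mem_kernel \<psi>_def)
qed

lemma (in seifert) flip_cone_sign:
  assumes P: "odd_cone e eps g n a b f" and f': "f' \<in> hom (grp b') parity_group"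
    and b': "b' = b(1 := - b 1)"
    and eq: "\<And>z. z \<in> gens \<Longrightarrow> f' (gen b' z) = f (gen b z)"
  shows "(grp b')\<lparr>carrier := kernel (grp b') parity_group f'\<rparr> \<cong> (grp b)\<lparr>carrier := kernel (grp b) parity_group f\<rparr>"
proof -
  interpret P: odd_cone e eps g n a b f by (rule P)
  have Q: "odd_cone e eps g n a b' f'"
    using f' P.f_s1 P.f_h P.f_v P.v1 P.cone_sign_1 eq cone_point
    by unfold_locales (simp_all add: eq)
  interpret Q: odd_cone e eps g n a b' f' by (rule Q)
  have b: "b = b'(1 := - b' 1)" by (simp add: b')
  obtain \<Theta> where T: "\<Theta> \<in> hom (grp b') (wreath2 P.even_part)"
    "\<And>z. z \<in> gens \<Longrightarrow> \<Theta> (gen b' z) = P.cover_push True z"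
    "\<And>x. x \<in> carrier (grp b') \<Longrightarrow> snd (snd (\<Theta> x)) \<longleftrightarrow> f' x = 1"
    using P.cover_hom[of f' True] f' eq unfolding b'[symmetric] by blast
  obtain \<Theta>' where T': "\<Theta>' \<in> hom (grp b) (wreath2 Q.even_part)"
    "\<And>z. z \<in> gens \<Longrightarrow> \<Theta>' (gen b z) = Q.cover_push (\<not> True) z"
    "\<And>x. x \<in> carrier (grp b) \<Longrightarrow> snd (snd (\<Theta>' x)) \<longleftrightarrow> f x = 1"
    using Q.cover_hom[of f "\<not> True"] P.f_hom eq unfolding b[symmetric] by metis
  have T'': "\<And>z. z \<in> gens \<Longrightarrow> \<Theta> (gen b' z) = P.cover_push (\<not> (\<not> True)) z" using T(2) by simp
  have "group_isomorphisms Q.even_part P.even_part (\<lambda>x. fst (\<Theta> x)) (\<lambda>x. fst (\<Theta>' x))"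
    unfolding group_isomorphisms_def
    using Q.wreath_hom_restrict[OF P.group_even_part T(1,3)]
      P.wreath_hom_restrict[OF Q.group_even_part T'(1,3)]
      flip_cone_sign_inverse[OF P Q b' T T'] flip_cone_sign_inverse[OF Q P b T' T(1) T'' T(3)]
    by simp
  then show ?thesis using group_isomorphisms_imp_iso is_isoI by blast
qed

section \<open>Comparison of the two kernels\<close>

lemma (in seifert) clear_parities:
  assumes "f \<in> hom (grp b) parity_group" "f (gen b (gen_s 1)) = 1" "finite J" "J \<subseteq> vs"
  shows "\<exists>b' f'. (b' = b \<or> b' = b(1 := - b 1) \<and> eps \<notin> {o1, n2}) \<and> f' \<in> hom (grp b') parity_group \<and>
    (\<forall>z\<in>gens. f' (gen b' z) = (if z \<in> gen_v ` J then 0 else f (gen b z))) \<and>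
    (grp b')\<lparr>carrier := kernel (grp b') parity_group f'\<rparr> \<cong> (grp b)\<lparr>carrier := kernel (grp b) parity_group f\<rparr>"
  using assms(3,4)
proof (induction J rule: finite_induct)
  case empty
  show ?case using assms(1) by (intro exI[of _ b] exI[of _ f]) (simp add: iso_refl)
next
  case (insert j J)
  have "J \<subseteq> vs" using insert.prems by simp
  then obtain b' f' where b': "b' = b \<or> b' = b(1 := - b 1) \<and> eps \<notin> {o1, n2}"
    and f': "f' \<in> hom (grp b') parity_group"
    and vals: "\<And>z. z \<in> gens \<Longrightarrow> f' (gen b' z) = (if z \<in> gen_v ` J then 0 else f (gen b z))"
    and iso: "(grp b')\<lparr>carrier := kernel (grp b') parity_group f'\<rparr> \<cong> (grp b)\<lparr>carrier := kernel (grp b) parity_group f\<rparr>"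
    using insert.IH by blast
  have j: "j \<in> vs" "gen_v j \<in> gens" "gen_v j \<notin> gen_v ` J" using insert by auto
  show ?case
  proof (cases "f (gen b (gen_v j)) = 0")
    case True
    have "\<forall>z\<in>gens. f' (gen b' z) = (if z \<in> gen_v ` insert j J then 0 else f (gen b z))"
      using vals True by auto
    then show ?thesis using b' f' iso by blast
  next
    case False
    interpret parity "grp b" f
      using assms(1) group_grp by (simp add: parity_def parity_axioms_def)
    have 1: "f (gen b (gen_v j)) = 1" using False parity_cases[OF gen_closed[OF j(2)]] by simp
    have "f' (gen b' (gen_s 1)) = 1"
      using vals[of "gen_s 1"] assms(2) cone_point by auto
    from change_parity[OF f' this j(1)] obtain f'' where
      f'': "f'' \<in> hom (grp (b'(1 := cone_sign j * b' 1))) parity_group"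
      "\<And>z. z \<in> gens \<Longrightarrow> f'' (gen (b'(1 := cone_sign j * b' 1)) z)
        = (if z = gen_v j then 1 - f' (gen b' z) else f' (gen b' z))"
      and iso'': "(grp (b'(1 := cone_sign j * b' 1)))\<lparr>carrier := kernel (grp (b'(1 := cone_sign j * b' 1))) parity_group f''\<rparr>
        \<cong> (grp b')\<lparr>carrier := kernel (grp b') parity_group f'\<rparr>"
      by blast
    have "cone_sign j = 1" if "eps \<in> {o1, n2}"
      using that by (auto simp: cone_sign_def orientable_base_def)
    then have "b'(1 := cone_sign j * b' 1) = b \<or> b'(1 := cone_sign j * b' 1) = b(1 := - b 1) \<and> eps \<notin> {o1, n2}"
      using b' cone_sign_cases[of j] by auto
    moreover have "\<forall>z\<in>gens. f'' (gen (b'(1 := cone_sign j * b' 1)) z) =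
        (if z \<in> gen_v ` insert j J then 0 else f (gen b z))"
      using f''(2) vals 1 j by auto
    ultimately show ?thesis using f''(1) iso_trans[OF iso'' iso] by blast
  qed
qed

text \<open>
Both parities are cleared on all \<open>v\<^sub>j\<close>. The groups reached are equal, and then the cleared
parities are equal too, or they differ in the sign of \<open>b\<^sub>1\<close>; the latter happens only for a
non-orientable total space, where the bound on the genus provides \<open>v\<^sub>1\<close>.
\<close>
lemma (in seifert) parity_kernels_isomorphic:
  assumes g: "min_genus eps \<le> g"
    and f: "f \<in> hom (grp b) parity_group" and f': "f' \<in> hom (grp b) parity_group"
    and s1: "f (gen b (gen_s 1)) = 1" and h: "f (gen b gen_h) = 0"
    and eq: "\<And>z. z \<in> gens - gen_v ` vs \<Longrightarrow> f (gen b z) = f' (gen b z)"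
  shows "(grp b)\<lparr>carrier := kernel (grp b) parity_group f\<rparr> \<cong> (grp b)\<lparr>carrier := kernel (grp b) parity_group f'\<rparr>"
proof -
  have non_v: "gen_s 1 \<in> gens - gen_v ` vs" "gen_h \<in> gens - gen_v ` vs" using cone_point by auto
  have s1': "f' (gen b (gen_s 1)) = 1" using s1 eq[OF non_v(1)] by simp
  define zero where "zero z = (if z \<in> gen_v ` vs then 0 else f (gen b z))" for z
  obtain c F where c: "c = b \<or> c = b(1 := - b 1) \<and> eps \<notin> {o1, n2}" and F: "F \<in> hom (grp c) parity_group"
      "\<And>z. z \<in> gens \<Longrightarrow> F (gen c z) = zero z"
    and iso: "(grp c)\<lparr>carrier := kernel (grp c) parity_group F\<rparr> \<cong> (grp b)\<lparr>carrier := kernel (grp b) parity_group f\<rparr>"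
    using clear_parities[OF f s1 finite_atLeastAtMost subset_refl] unfolding zero_def by blast
  obtain c' F' where c': "c' = b \<or> c' = b(1 := - b 1) \<and> eps \<notin> {o1, n2}" and F': "F' \<in> hom (grp c') parity_group"
      "\<And>z. z \<in> gens \<Longrightarrow> F' (gen c' z) = (if z \<in> gen_v ` vs then 0 else f' (gen b z))"
    and iso': "(grp c')\<lparr>carrier := kernel (grp c') parity_group F'\<rparr> \<cong> (grp b)\<lparr>carrier := kernel (grp b) parity_group f'\<rparr>"
    using clear_parities[OF f' s1' finite_atLeastAtMost subset_refl] by blast
  have F'_zero: "F' (gen c' z) = zero z" if "z \<in> gens" for z
    using F'(2)[OF that] eq[of z] that by (auto simp: zero_def)
  have "(grp c')\<lparr>carrier := kernel (grp c') parity_group F'\<rparr> \<cong> (grp c)\<lparr>carrier := kernel (grp c) parity_group F\<rparr>"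
  proof (cases "c' = c")
    case True
    have "F' x = F x" if "x \<in> carrier (grp c)" for x
      using hom_unique[OF group_integer_mod_group F'(1)[unfolded True] F(1) _ that] F(2) F'_zero True by simp
    then have "kernel (grp c') parity_group F' = kernel (grp c) parity_group F"
      by (auto simp: kernel_def True)
    then show ?thesis by (simp add: True iso_refl)
  next
    case False
    then have non_orientable: "eps \<notin> {o1, n2}" and c'_c: "c' = c(1 := - c 1)" using c c' by auto
    have "cone_sign 1 = - 1"
      unfolding cone_sign_def using non_orientable by (cases eps) (auto simp: orientable_base_def)
    moreover have "1 \<in> vs" using non_orientable g by (cases eps) (auto simp: num_v_def orientable_base_def)
    ultimately have "odd_cone e eps g n a c F"
      using F s1 h non_v by unfold_locales (auto simp: zero_def)
    then show ?thesis
      using F(2) F'_zero by (intro flip_cone_sign[OF _ F'(1) c'_c]) simp_all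
  qed
  moreover have "group ((grp c)\<lparr>carrier := kernel (grp c) parity_group F\<rparr>)" "group ((grp c')\<lparr>carrier := kernel (grp c') parity_group F'\<rparr>)"
    using F(1) F'(1) group_grp by (auto intro!: parity.group_even_part simp: parity_def parity_axioms_def)
  ultimately show ?thesis
    using iso iso' by (meson group.iso_sym iso_trans)
qed

theorem lemma10:
  fixes e :: int and eps :: seifert_type and g n m :: nat and a b :: "nat \<Rightarrow> int"
    and f f' :: "seifert_gen word set \<Rightarrow> int"
  defines "G \<equiv> seifert_group e eps g n a b"
    and "x \<equiv> seifert_elem e eps g n a b"
    and "Z2 \<equiv> integer_mod_group 2"
  assumes "seifert_invariants eps g n a b"
    and "0 < m" and "m \<le> n"
    and "f \<in> hom G Z2" and "f' \<in> hom G Z2"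
    and "\<forall>k\<in>{1..m}. f (x (gen_s k)) = 1" and "\<forall>k\<in>{1..m}. f' (x (gen_s k)) = 1"
    and "f (x gen_h) = 0" and "f' (x gen_h) = 0"
    and "\<forall>k\<in>{m+1..n}. f (x (gen_s k)) = 0" and "\<forall>k\<in>{m+1..n}. f' (x (gen_s k)) = 0"
  shows "G\<lparr>carrier := kernel G Z2 f\<rparr> \<cong> G\<lparr>carrier := kernel G Z2 f'\<rparr>"
proof -
  interpret seifert e eps g n a
    using assms(5,6) by unfold_locales simp
  have "f (x z) = f' (x z)" if z: "z \<in> gens - gen_v ` vs" for z
  proof (cases z)
    case (gen_s k)
    then have "k \<in> {1..m} \<or> k \<in> {m+1..n}" using z by auto
    then show ?thesis using assms(9,10,13,14) gen_s by auto
  qed (use z assms(11,12) in auto)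
  moreover have "f (x (gen_s 1)) = 1" using assms(5,9) by simp
  ultimately show ?thesis
    using parity_kernels_isomorphic assms(4,7,8,11)
    unfolding G_def x_def Z2_def seifert_invariants_def by blast
qed

end
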